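(* Let $G$ be a locally compact second countable group and let $G\curvearrowright (X,\mu)$ be a nonsingular measurable action on a standard probability space. Then this action is isomorphic to a continuous action on a compact metric space; that is, there are a compact metrizable space $K$, a continuous action $G\curvearrowright K$ (the map $G\times K\to K$ is continuous), a Borel probability measure $\nu$ on $K$ that is nonsingular for this action, and an essentially invertible measure-preserving map $\phi\colon (X,\mu)\to (K,\nu)$ that for every $g\in G$ is $g$-equivariant almost everywhere.
   Context: A nonsingular measurable action of $G$ on $(X,\mu)$ is a group action such that $G\times X\to X$ is measurable and $g_*\mu$ and $\mu$ are mutually absolutely continuous for every $g\in G$. A measure-preserving map is essentially invertible if, after restricting to suitable measurable subsets of full measure of its domain and codomain, it is a bijection with measurable inverse. *)

theory Defs
  imports "HOL-Probability.Probability"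
begin

text \<open>
  Groups are rendered by the library's class of (not necessarily commutative) topological groups,
  \<^class>\<open>topological_group_add\<close>; the group operation is therefore written additively, although it is
  not assumed to be commutative.

  HOL cannot quantify existentially over types, so a compact metrizable space that is asserted to
  exist is given as an abstract topology on a set of points of type \<^typ>\<open>nat \<Rightarrow> real\<close>.  This loses
  no generality: a compact metrizable space has at most continuum many points.
\<close>

definition borel_of :: "'a topology \<Rightarrow> 'a measure" where
  "borel_of T = sigma (topspace T) {U. openin T U}"

definition standard_probability_space :: "'x measure \<Rightarrow> bool" where
  "standard_probability_space M \<longleftrightarrow>
     prob_space M \<and>
     (\<exists>T. completely_metrizable_space T \<and> separable_space T \<and> sets M = sets (borel_of T))"

definition is_action_on :: "'x set \<Rightarrow> ('g::group_add \<Rightarrow> 'x \<Rightarrow> 'x) \<Rightarrow> bool" where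
  "is_action_on S act \<longleftrightarrow>
     (\<forall>g. \<forall>x\<in>S. act g x \<in> S) \<and>
     (\<forall>x\<in>S. act 0 x = x) \<and>
     (\<forall>g h. \<forall>x\<in>S. act (g + h) x = act g (act h x))"

definition measurable_action :: "'x measure \<Rightarrow> ('g::{group_add,topological_space} \<Rightarrow> 'x \<Rightarrow> 'x) \<Rightarrow> bool"
  where "measurable_action M act \<longleftrightarrow>
     is_action_on (space M) act \<and> (\<lambda>(g, x). act g x) \<in> measurable (borel \<Otimes>\<^sub>M M) M"

definition continuous_action :: "'x topology \<Rightarrow> ('g::{group_add,topological_space} \<Rightarrow> 'x \<Rightarrow> 'x) \<Rightarrow> bool"
  where "continuous_action K act \<longleftrightarrow>
     is_action_on (topspace K) act \<and>
     continuous_map (prod_topology euclidean K) K (\<lambda>(g, x). act g x)"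

text \<open>
  This is only meaningful if every map \<open>act g\<close> is measurable, since \<^const>\<open>distr\<close> is a junk value
  otherwise.  That is part of \<^const>\<open>measurable_action\<close>, and for a \<^const>\<open>continuous_action\<close> it
  follows from continuity.
\<close>

definition nonsingular_for :: "'x measure \<Rightarrow> ('g \<Rightarrow> 'x \<Rightarrow> 'x) \<Rightarrow> bool" where
  "nonsingular_for M act \<longleftrightarrow>
     (\<forall>g. absolutely_continuous M (distr M M (act g)) \<and>
          absolutely_continuous (distr M M (act g)) M)"

definition measure_preserving_map :: "'x measure \<Rightarrow> 'y measure \<Rightarrow> ('x \<Rightarrow> 'y) \<Rightarrow> bool" where
  "measure_preserving_map M N f \<longleftrightarrow> f \<in> measurable M N \<and>
     (\<forall>B\<in>sets N. emeasure M (f -` B \<inter> space M) = emeasure N B)"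

definition essentially_invertible :: "'x measure \<Rightarrow> 'y measure \<Rightarrow> ('x \<Rightarrow> 'y) \<Rightarrow> bool" where
  "essentially_invertible M N f \<longleftrightarrow>
     (\<exists>A\<in>sets M. \<exists>B\<in>sets N.
        space M - A \<in> null_sets M \<and> space N - B \<in> null_sets N \<and>
        bij_betw f A B \<and>
        inv_into A f \<in> measurable (restrict_space N B) (restrict_space M A))"

end

theory Submission
  imports Defs
begin

text \<open>
  Baire category on the group replaces Haar measure. For measurable \<open>A\<close> and a continuous bump
  function \<open>k\<close> at \<open>0\<close> with compact support, let \<open>F x g\<close> be the supremum of \<open>h \<mapsto> k (h - g)\<close> over
  \<open>{h. act h x \<in> A}\<close>, ignoring meager sets. By the Montgomery--Novikov theorem \<open>F x g\<close> is measurable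
  in \<open>x\<close>; uniform continuity of \<open>k\<close> makes all the functions \<open>F x\<close> equicontinuous with a modulus
  depending only on \<open>h - g\<close>; and \<open>F (act a x) h = F x (h + a)\<close>. So \<open>x \<mapsto> F x\<close> maps equivariantly into
  the right-shift action on a compact metrizable space of equicontinuous functions. With countably
  many \<open>A\<close> separating points and \<open>k\<close> of shrinking support the map is injective: if \<open>x \<noteq> y\<close>, then
  some \<open>A\<close> satisfies \<open>act h x \<in> A\<close> and \<open>act h y \<notin> A\<close> for comeagerly many \<open>h\<close> in a non-empty open
  set. Finally, inner regularity of the measure on the graph of this map yields the measurable inverse.
\<close>

section \<open>Meager sets and the Baire property\<close>

text \<open>Covering by closed nowhere dense sets makes subsets of meager sets meager at once and
  matches the form of the Baire category theorem.\<close>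

definition meager :: "'a::topological_space set \<Rightarrow> bool" where
  "meager S \<longleftrightarrow> (\<exists>\<C>. countable \<C> \<and> (\<forall>C\<in>\<C>. closed C \<and> interior C = {}) \<and> S \<subseteq> \<Union>\<C>)"

lemma meager_subset: "meager T \<Longrightarrow> S \<subseteq> T \<Longrightarrow> meager S"
  unfolding meager_def by (meson order_trans)

lemma meager_Union:
  assumes "countable \<S>" and "\<And>S. S \<in> \<S> \<Longrightarrow> meager S"
  shows "meager (\<Union>\<S>)"
proof -
  obtain \<C> where \<C>: "countable (\<C> S)" "\<forall>C\<in>\<C> S. closed C \<and> interior C = {}" "S \<subseteq> \<Union>(\<C> S)"
    if "S \<in> \<S>" for S
    using assms(2) unfolding meager_def by metis
  have "countable (\<Union>S\<in>\<S>. \<C> S)"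
    using assms(1) \<C>(1) by blast
  moreover have "\<forall>C\<in>(\<Union>S\<in>\<S>. \<C> S). closed C \<and> interior C = {}"
    using \<C>(2) by blast
  moreover have "\<Union>\<S> \<subseteq> \<Union>(\<Union>S\<in>\<S>. \<C> S)"
  proof (rule Union_least)
    fix S assume "S \<in> \<S>"
    then show "S \<subseteq> \<Union>(\<Union>S\<in>\<S>. \<C> S)"
      using \<C>(3)[of S] by blast
  qed
  ultimately show ?thesis
    unfolding meager_def by blast
qed

lemma meager_UN:
  assumes "countable I" and "\<And>i. i \<in> I \<Longrightarrow> meager (S i)"
  shows "meager (\<Union>i\<in>I. S i)"
  using assms by (intro meager_Union) auto

lemma meager_empty: "meager {}"
  unfolding meager_def by (intro exI[of _ "{}"]) auto

lemma meager_Un: "meager S \<Longrightarrow> meager T \<Longrightarrow> meager (S \<union> T)"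
  using meager_Union[of "{S, T}"] by auto

text \<open>The boundary of an open set is closed and nowhere dense; hence
  \<open>- closure V\<close> can stand in for \<open>- V\<close> modulo meager sets.\<close>

lemma meager_closure_diff:
  assumes "open V"
  shows "meager (closure V - V)"
proof -
  have "interior (closure V - V) = {}"
  proof (rule equals0I)
    fix x assume "x \<in> interior (closure V - V)"
    then have "x \<in> closure V" and "interior (closure V - V) \<inter> V = {}"
      using interior_subset by blast+
    with \<open>x \<in> interior _\<close> show False
      by (meson disjoint_iff open_Int_closure_eq_empty open_interior)
  qed
  moreover have "closed (closure V - V)"
    using assms by (simp add: closed_Diff)
  ultimately show ?thesis
    unfolding meager_def by (intro exI[of _ "{closure V - V}"]) auto
qed

text \<open>The Baire category theorem for locally compact regular spaces; regularity comes from the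
  Hausdorff property.\<close>

lemma open_not_meager:
  fixes U :: "'a::t2_space set"
  assumes "locally_compact_space (euclidean :: 'a topology)" and "open U" and "U \<noteq> {}"
  shows "\<not> meager U"
proof
  assume "meager U"
  then obtain \<C> where \<C>: "countable \<C>" "\<forall>C\<in>\<C>. closed C \<and> interior C = {}" "U \<subseteq> \<Union>\<C>"
    unfolding meager_def by blast
  have "Hausdorff_space (euclidean :: 'a topology)"
    unfolding Hausdorff_space_def by (metis disjnt_def hausdorff open_openin)
  then have "regular_space (euclidean :: 'a topology)"
    using assms(1) locally_compact_Hausdorff_imp_regular_space by blast
  then have "euclidean interior_of \<Union>\<C> = {}"
    using assms(1) \<C> by (intro Baire_category_alt) auto
  then show False
    using \<C>(3) assms(2,3) interior_maximal[of U "\<Union>\<C>"] by simp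
qed

definition baire_property :: "'a::topological_space set \<Rightarrow> bool" where
  "baire_property S \<longleftrightarrow> (\<exists>V. open V \<and> meager (S - V) \<and> meager (V - S))"

lemma baire_property_open: "open S \<Longrightarrow> baire_property S"
  unfolding baire_property_def using meager_empty by (intro exI[of _ S]) auto

text \<open>If \<open>S\<close> agrees with the open set \<open>V\<close> modulo meager sets, then
  \<open>- S\<close> agrees with the open set \<open>- closure V\<close>: only the boundary of
  \<open>V\<close> is lost.\<close>

lemma baire_property_Compl:
  assumes "baire_property S"
  shows "baire_property (- S)"
proof -
  obtain V where V: "open V" "meager (S - V)" "meager (V - S)"
    using assms unfolding baire_property_def by blast
  have "meager (- S - (- closure V))"
    using meager_Un[OF meager_closure_diff[OF V(1)] V(3)] by (rule meager_subset) auto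
  moreover have "meager (- closure V - (- S))"
    using V(2) by (rule meager_subset) (use closure_subset in blast)
  ultimately show ?thesis
    unfolding baire_property_def by (intro exI[of _ "- closure V"]) auto
qed

lemma baire_property_UN:
  assumes "\<And>i::nat. baire_property (S i)"
  shows "baire_property (\<Union>i. S i)"
proof -
  obtain V where V: "open (V i)" "meager (S i - V i)" "meager (V i - S i)" for i
    using assms unfolding baire_property_def by metis
  have "meager (\<Union>i. S i - V i)" "meager (\<Union>i. V i - S i)"
    using V by (auto intro: meager_UN)
  then have "meager ((\<Union>i. S i) - (\<Union>i. V i))" "meager ((\<Union>i. V i) - (\<Union>i. S i))"
    by (auto intro: meager_subset[OF \<open>meager (\<Union>i. S i - V i)\<close>]
        meager_subset[OF \<open>meager (\<Union>i. V i - S i)\<close>])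
  then show ?thesis
    unfolding baire_property_def using V(1) by blast
qed

lemma baire_property_Int:
  assumes "baire_property S" "baire_property T"
  shows "baire_property (S \<inter> T)"
proof -
  have "S \<inter> T = - (\<Union>i. if i = (0::nat) then - S else - T)"
    by (auto split: if_splits)
  moreover have "baire_property (\<Union>i. if i = (0::nat) then - S else - T)"
    using assms by (intro baire_property_UN) (simp add: baire_property_Compl)
  ultimately show ?thesis
    by (metis baire_property_Compl)
qed

lemma baire_property_borel:
  assumes "S \<in> sets borel"
  shows "baire_property S"
proof -
  have "S \<in> sigma_sets UNIV {U. open U}"
    using assms by (simp add: sets_borel)
  then show ?thesis
    by induction
      (auto simp: Compl_eq_Diff_UNIV[symmetric]
        intro: baire_property_open baire_property_Compl baire_property_UN)
qed

text \<open>The open set that equals \<open>S\<close> modulo meager sets serves as \<open>U\<close>;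
  were it empty, \<open>S\<close> itself would be meager.\<close>

lemma baire_property_comeager_in_open:
  assumes "baire_property S" and "\<not> meager S"
  obtains U where "open U" "U \<noteq> {}" "meager (U - S)"
proof -
  obtain V where V: "open V" "meager (S - V)" "meager (V - S)"
    using assms unfolding baire_property_def by blast
  moreover have "V \<noteq> {}"
    using V(2) assms(2) by auto
  ultimately show ?thesis
    using that by blast
qed

text \<open>Right translations are homeomorphisms. The right side is the relevant one, because
  passing from \<open>x\<close> to \<open>act a x\<close> replaces the time \<open>h\<close> by
  \<open>h + a\<close>.\<close>

lemma meager_translate:
  fixes S :: "'g::topological_group_add set"
  assumes "meager S"
  shows "meager ((\<lambda>h. h + a) -` S)"
proof -
  obtain \<C> where \<C>: "countable \<C>" "\<forall>C\<in>\<C>. closed C \<and> interior C = {}" "S \<subseteq> \<Union>\<C>"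
    using assms unfolding meager_def by blast
  have cont: "continuous_on UNIV (\<lambda>h. h + b)" for b :: 'g
    by (intro continuous_intros)
  have "closed ((\<lambda>h. h + a) -` C) \<and> interior ((\<lambda>h. h + a) -` C) = {}" if "C \<in> \<C>" for C
  proof
    show "closed ((\<lambda>h. h + a) -` C)"
      using \<C>(2) that cont by (intro closed_vimage) auto
    show "interior ((\<lambda>h. h + a) -` C) = {}"
    proof (rule equals0I)
      fix x assume x: "x \<in> interior ((\<lambda>h. h + a) -` C)"
      \<comment> \<open>\<open>?W\<close> is the interior of the preimage, translated by
        \<open>a\<close>; it is an open subset of \<open>C\<close>.\<close>
      let ?W = "(\<lambda>h. h + - a) -` interior ((\<lambda>h. h + a) -` C)"
      have "open ?W"
        by (rule open_vimage[OF open_interior cont])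
      moreover have "?W \<subseteq> C"
      proof
        fix h assume "h \<in> ?W"
        then have "h + - a \<in> (\<lambda>h. h + a) -` C"
          using interior_subset by fast
        then show "h \<in> C" by (simp add: add.assoc)
      qed
      ultimately have "?W \<subseteq> interior C"
        by (simp add: interior_maximal)
      moreover have "x + a \<in> ?W"
        using x by (simp add: add.assoc)
      ultimately show False
        using \<C>(2) that by blast
    qed
  qed
  moreover have "(\<lambda>h. h + a) -` S \<subseteq> \<Union>((-`) (\<lambda>h. h + a) ` \<C>)"
    using \<C>(3) by (simp flip: vimage_Union add: vimage_mono)
  ultimately show ?thesis
    unfolding meager_def using \<C>(1)
    by (intro exI[of _ "(-`) (\<lambda>h. h + a) ` \<C>"]) simp
qed

lemma meager_translate_iff:
  fixes S :: "'g::topological_group_add set"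
  shows "meager ((\<lambda>h. h + a) -` S) \<longleftrightarrow> meager S"
proof
  assume "meager ((\<lambda>h. h + a) -` S)"
  from meager_translate[OF this, of "- a"] show "meager S"
    by (simp add: vimage_def add.assoc)
qed (rule meager_translate)

text \<open>The Montgomery--Novikov theorem. Complements are handled by the Baire property of the sections:
  a section is non-meager in \<open>U\<close> iff its complement is meager in some non-empty open subset of \<open>U\<close>.\<close>

lemma sets_nonmeager_sections:
  fixes N :: "'x measure" and B :: "('g::{t2_space, second_countable_topology} \<times> 'x) set"
  assumes lc: "locally_compact_space (euclidean :: 'g topology)"
    and B: "B \<in> sets (borel \<Otimes>\<^sub>M N)" and U: "open U"
  shows "{x \<in> space N. \<not> meager (U \<inter> {h. (h, x) \<in> B})} \<in> sets N"
proof -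
  obtain \<B> :: "'g set set" where \<B>: "countable \<B>" "topological_basis \<B>"
    using ex_countable_basis by blast
  let ?E = "{P \<times> Q |P Q. P \<in> sets (borel :: 'g measure) \<and> Q \<in> sets N}"
  have "B \<in> sigma_sets (UNIV \<times> space N) ?E"
    using B by (simp add: sets_pair_measure)
  \<comment> \<open>The complement step uses the claim for all basic open subsets of
    \<open>U\<close> and the Baire property of the sections, so both belong to the induction
    claim.\<close>
  then have "(\<forall>x\<in>space N. baire_property {h. (h, x) \<in> B}) \<and>
      (\<forall>U. open U \<longrightarrow> {x \<in> space N. \<not> meager (U \<inter> {h. (h, x) \<in> B})} \<in> sets N)"
  proof induction
    case (Basic B)
    then obtain P Q where PQ: "B = P \<times> Q" "P \<in> sets borel" "Q \<in> sets N"
      by blast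
    have "{h. (h, x) \<in> B} = (if x \<in> Q then P else {})" for x
      using PQ by auto
    moreover have "{x \<in> space N. \<not> meager (U \<inter> (if x \<in> Q then P else {}))}
        = (if meager (U \<inter> P) then {} else Q)" for U
      using sets.sets_into_space[OF PQ(3)] by (auto simp: meager_empty)
    ultimately show ?case
      using PQ by (auto simp: baire_property_borel)
  next
    case Empty
    then show ?case by (simp add: meager_empty baire_property_open)
  next
    case (Compl B)
    have sect: "{h. (h, x) \<in> UNIV \<times> space N - B} = - {h. (h, x) \<in> B}" if "x \<in> space N" for x
      using that by auto
    \<comment> \<open>Taking \<open>W\<close> only from the countable basis keeps the union
      countable.\<close>
    have "{x \<in> space N. \<not> meager (U \<inter> {h. (h, x) \<in> UNIV \<times> space N - B})}
        = (\<Union>W\<in>{W \<in> \<B>. W \<subseteq> U \<and> W \<noteq> {}}.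
            space N - {x \<in> space N. \<not> meager (W \<inter> {h. (h, x) \<in> B})})"
      (is "?L U = ?R U") if U: "open U" for U
    proof (intro set_eqI iffI)
      fix x assume x: "x \<in> ?L U"
      then have nm: "\<not> meager (U \<inter> - {h. (h, x) \<in> B})"
        using sect[of x] by (metis (lifting) mem_Collect_eq)
      have bp: "baire_property (U \<inter> - {h. (h, x) \<in> B})"
        using x Compl
        by (intro baire_property_Int[OF baire_property_open[OF U] baire_property_Compl]) auto
      obtain V where V: "open V" "V \<noteq> {}" "meager (V - (U \<inter> - {h. (h, x) \<in> B}))"
        by (rule baire_property_comeager_in_open[OF bp nm])
      \<comment> \<open>Nothing places \<open>V\<close> inside \<open>U\<close>, but a
        \<open>V\<close> disjoint from \<open>U\<close> would be meager, contradicting Baire. In any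
        \<open>W\<close> inside the intersection, the section of \<open>B\<close> is meager.\<close>
      have "V \<inter> U \<noteq> {}"
      proof
        assume "V \<inter> U = {}"
        then have "meager V" using V(3) by (auto elim: meager_subset)
        then show False using open_not_meager[OF lc V(1,2)] by simp
      qed
      then obtain W where W: "W \<in> \<B>" "W \<subseteq> V \<inter> U" "W \<noteq> {}"
        using \<B>(2) V(1) U by (metis all_not_in_conv open_Int topological_basisE)
      have "meager (W \<inter> {h. (h, x) \<in> B})"
        using V(3) by (rule meager_subset) (use W in auto)
      then show "x \<in> ?R U" using W x by auto
    next
      fix x assume "x \<in> ?R U"
      then obtain W where W: "W \<in> \<B>" "W \<subseteq> U" "W \<noteq> {}" "x \<in> space N"
        "meager (W \<inter> {h. (h, x) \<in> B})"
        by auto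
      have "\<not> meager W"
        using W \<B>(2) open_not_meager[OF lc] topological_basis_open by blast
      have "\<not> meager (U \<inter> - {h. (h, x) \<in> B})"
      proof
        assume "meager (U \<inter> - {h. (h, x) \<in> B})"
        from meager_Un[OF this W(5)] have "meager W"
          by (rule meager_subset) (use W(2) in auto)
        with \<open>\<not> meager W\<close> show False ..
      qed
      then show "x \<in> ?L U"
        using W sect[of x] by simp
    qed
    moreover have "?R U \<in> sets N" for U
      using \<B> Compl topological_basis_open[OF \<B>(2)]
      by (intro sets.countable_UN'' sets.Diff sets.top) auto
    moreover have "baire_property {h. (h, x) \<in> UNIV \<times> space N - B}" if "x \<in> space N" for x
      using Compl that by (simp only: sect baire_property_Compl)
    ultimately show ?case
      by simp
  next
    case (Union B)
    have sect: "{h. (h, x) \<in> (\<Union>i. B i)} = (\<Union>i. {h. (h, x) \<in> B i})" for x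
      by auto
    have "{x \<in> space N. \<not> meager (U \<inter> {h. (h, x) \<in> (\<Union>i. B i)})}
        = (\<Union>i. {x \<in> space N. \<not> meager (U \<inter> {h. (h, x) \<in> B i})})" for U
    proof -
      have "meager (U \<inter> {h. (h, x) \<in> (\<Union>i. B i)}) \<longleftrightarrow> (\<forall>i. meager (U \<inter> {h. (h, x) \<in> B i}))" for x
      proof
        assume m: "meager (U \<inter> {h. (h, x) \<in> (\<Union>i. B i)})"
        show "\<forall>i. meager (U \<inter> {h. (h, x) \<in> B i})"
          by (intro allI meager_subset[OF m]) auto
      next
        assume "\<forall>i. meager (U \<inter> {h. (h, x) \<in> B i})"
        then have "meager (\<Union>i. U \<inter> {h. (h, x) \<in> B i})"
          by (intro meager_UN) auto
        then show "meager (U \<inter> {h. (h, x) \<in> (\<Union>i. B i)})"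
          by (rule meager_subset) auto
      qed
      then show ?thesis by auto
    qed
    moreover have "baire_property {h. (h, x) \<in> (\<Union>i. B i)}" if "x \<in> space N" for x
      using Union that by (simp only: sect) (intro baire_property_UN, simp)
    ultimately show ?case
      using Union by (auto intro!: sets.countable_UN)
  qed
  then show ?thesis using U by blast
qed

section \<open>Bump functions\<close>

text \<open>Complete regularity gives a function that is 0 at the identity and 1 off a neighbourhood
  lying in \<open>V\<close> and in a compact set; \<open>k\<close> is one minus it. Vanishing off a
  compact set makes the last estimate uniform in \<open>h\<close>.\<close>

lemma exists_uniformly_continuous_bump:
  fixes V :: "'g::{topological_group_add, t2_space} set"
  assumes lc: "locally_compact_space (euclidean :: 'g topology)" and V: "open V" "0 \<in> V"
  obtains k :: "'g \<Rightarrow> real" where "\<And>h. 0 \<le> k h" "\<And>h. k h \<le> 1" "continuous_on UNIV k" "k 0 = 1"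
    "\<And>h. h \<notin> V \<Longrightarrow> k h = 0"
    "\<And>\<epsilon>. \<epsilon> > 0 \<Longrightarrow> \<exists>W. open W \<and> 0 \<in> W \<and> (\<forall>s\<in>W. \<forall>h. \<bar>k (h + s) - k h\<bar> \<le> \<epsilon>)"
proof -
  have "\<exists>U C. openin euclidean U \<and> compactin euclidean C \<and> (0::'g) \<in> U \<and> U \<subseteq> C"
    using lc unfolding locally_compact_space_def by simp
  then obtain U C where U: "open U" "compact C" "(0::'g) \<in> U" "U \<subseteq> C"
    unfolding open_openin[symmetric] compactin_euclidean_iff by blast
  have "Hausdorff_space (euclidean :: 'g topology)"
    unfolding Hausdorff_space_def by (metis disjnt_def hausdorff open_openin)
  then have "completely_regular_space (euclidean :: 'g topology)"
    using lc locally_compact_Hausdorff_imp_regular_space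
      locally_compact_regular_imp_completely_regular_space by blast
  moreover have "closedin euclidean (- (U \<inter> V))" and "0 \<in> topspace euclidean - (- (U \<inter> V))"
    using U V by auto
  ultimately obtain f :: "'g \<Rightarrow> real" where f: "continuous_map euclidean (top_of_set {0..1}) f"
    "f 0 = 0" "f ` (- (U \<inter> V)) \<subseteq> {1}"
    unfolding completely_regular_space_def by blast
  have fcont: "continuous_on UNIV f" and f01: "f h \<in> {0..1}" for h
    using f(1) continuous_map_in_subtopology[of euclidean euclidean "{0..1}" f] by auto
  define k where "k h = 1 - f h" for h
  have kcont: "continuous_on UNIV k"
    unfolding k_def using fcont by (intro continuous_intros)
  have supp: "k h = 0" if "h \<notin> C \<or> h \<notin> V" for h
    using f(3) that U(4) unfolding k_def by force
  have unif: "\<exists>W. open W \<and> 0 \<in> W \<and> (\<forall>s\<in>W. \<forall>h. \<bar>k (h + s) - k h\<bar> \<le> \<epsilon>)" if "\<epsilon> > 0" for \<epsilon>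
  proof -
    \<comment> \<open>Compactness of \<open>C\<close> turns joint continuity at \<open>s = 0\<close>
      into one neighbourhood \<open>X\<close> that works for all \<open>h\<close> in
      \<open>C\<close>.\<close>
    have "continuous_on (UNIV \<times> C) (\<lambda>(s, h). k (h + s))"
      unfolding case_prod_unfold
      by (intro continuous_on_compose2[OF kcont]) (auto intro!: continuous_intros)
    from this U(2) UNIV_I that obtain X where X: "0 \<in> X" "open X"
      "\<forall>s\<in>X \<inter> UNIV. \<forall>h\<in>C. dist (case (s, h) of (s, h) \<Rightarrow> k (h + s)) (case (0, h) of (s, h) \<Rightarrow> k (h + s)) \<le> \<epsilon>"
      by (rule continuous_on_prod_compactE)
    then have close: "\<bar>k (h + s) - k h\<bar> \<le> \<epsilon>" if "s \<in> X" "h \<in> C" for s h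
      using that by (simp add: dist_real_def)
    \<comment> \<open>Symmetry of \<open>W\<close> covers the case where only \<open>h + s\<close>
      lies in \<open>C\<close>: shift back by \<open>- s\<close>. If neither point lies in
      \<open>C\<close>, both values vanish.\<close>
    define W where "W = X \<inter> uminus -` X"
    have "open W"
      unfolding W_def using X(2)
      by (intro open_Int open_vimage) (auto intro!: continuous_intros)
    moreover have "\<bar>k (h + s) - k h\<bar> \<le> \<epsilon>" if s: "s \<in> W" for s h
    proof (cases "h \<in> C")
      case True
      then show ?thesis using close s unfolding W_def by blast
    next
      case False
      show ?thesis
      proof (cases "h + s \<in> C")
        case True
        then have "\<bar>k (h + s + - s) - k (h + s)\<bar> \<le> \<epsilon>"
          using close[of "- s" "h + s"] s unfolding W_def by simp
        then show ?thesis by (simp add: add.assoc abs_minus_commute)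
      next
        case F: False
        then show ?thesis using False supp[of h] supp[of "h + s"] that \<open>\<epsilon> > 0\<close> by simp
      qed
    qed
    ultimately show ?thesis
      using X(1) unfolding W_def by (intro exI[of _ W]) (auto simp: W_def)
  qed
  show ?thesis
    by (rule that[of k, OF _ _ kcont _ _ unif]) (use f01 f(2) supp in \<open>auto simp: k_def\<close>)
qed

section \<open>Suprema modulo meager sets\<close>

text \<open>The truncation at \<open>0\<close> makes the supremum meaningful for meager \<open>S\<close>.\<close>

definition category_sup :: "'a::topological_space set \<Rightarrow> ('a \<Rightarrow> real) \<Rightarrow> real" where
  "category_sup S f = Sup (insert 0 {c. \<not> meager {h \<in> S. f h > c}})"

lemma nonmeager_level_le_one:
  fixes f :: "'a::topological_space \<Rightarrow> real"
  assumes "\<And>h. f h \<le> 1" and "c \<in> insert 0 {c. \<not> meager {h \<in> S. f h > c}}"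
  shows "c \<le> 1"
proof (rule ccontr)
  assume "\<not> c \<le> 1"
  then have "\<not> f h > c" for h
    using assms(1)[of h] by simp
  with assms(2) \<open>\<not> c \<le> 1\<close> show False by (simp add: meager_empty)
qed

lemma bdd_above_category_sup:
  fixes f :: "'a::topological_space \<Rightarrow> real"
  assumes "\<And>h. f h \<le> 1"
  shows "bdd_above (insert 0 {c. \<not> meager {h \<in> S. f h > c}})"
  using nonmeager_level_le_one[of f, OF assms] by (rule bdd_aboveI)

lemma category_sup_nonneg:
  assumes "\<And>h. f h \<le> 1"
  shows "0 \<le> category_sup S f"
  unfolding category_sup_def by (intro cSup_upper bdd_above_category_sup assms) simp

lemma category_sup_upper:
  assumes "\<And>h. f h \<le> 1" "\<not> meager {h \<in> S. f h > c}"
  shows "c \<le> category_sup S f"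
  unfolding category_sup_def using assms(2)
  by (intro cSup_upper bdd_above_category_sup assms(1)) simp

lemma category_sup_le_one:
  assumes "\<And>h. f h \<le> 1"
  shows "category_sup S f \<le> 1"
  unfolding category_sup_def
  by (rule cSup_least[OF insert_not_empty nonmeager_level_le_one[of f, OF assms]])

text \<open>Rational levels reduce the comparison to countably many meagerness conditions;
  \<open>0 \<le> c\<close> ensures that the inserted 0 is not what exceeds \<open>c\<close>.\<close>

lemma less_category_sup_iff:
  assumes "\<And>h. f h \<le> 1" and "0 \<le> c"
  shows "c < category_sup S f \<longleftrightarrow> (\<exists>q\<in>\<rat>. c < q \<and> \<not> meager {h \<in> S. f h > q})"
proof
  assume "c < category_sup S f"
  then obtain d where d: "d \<in> insert 0 {c. \<not> meager {h \<in> S. f h > c}}" "c < d"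
    unfolding category_sup_def by (rule less_cSupE) auto
  then have nm: "\<not> meager {h \<in> S. f h > d}"
    using assms(2) by auto
  obtain q where q: "q \<in> \<rat>" "c < q" "q < d"
    using Rats_dense_in_real[OF d(2)] by blast
  have "\<not> meager {h \<in> S. f h > q}"
  proof
    assume "meager {h \<in> S. f h > q}"
    then have "meager {h \<in> S. f h > d}"
      by (rule meager_subset) (use q in auto)
    with nm show False ..
  qed
  with q show "\<exists>q\<in>\<rat>. c < q \<and> \<not> meager {h \<in> S. f h > q}" by blast
next
  assume "\<exists>q\<in>\<rat>. c < q \<and> \<not> meager {h \<in> S. f h > q}"
  then show "c < category_sup S f"
    using category_sup_upper[of f S] assms(1) by (meson less_le_trans)
qed

text \<open>The part of \<open>S\<close> where \<open>f\<close> is positive is the countable union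
  of the parts above positive rational levels, so it is non-meager iff one of these is.\<close>

lemma category_sup_pos_iff:
  assumes "\<And>h. f h \<le> 1"
  shows "0 < category_sup S f \<longleftrightarrow> \<not> meager {h \<in> S. f h > 0}"
proof
  assume "0 < category_sup S f"
  then obtain q where q: "0 < q" "\<not> meager {h \<in> S. f h > q}"
    using assms less_category_sup_iff[of f 0 S] by auto
  show "\<not> meager {h \<in> S. f h > 0}"
  proof
    assume "meager {h \<in> S. f h > 0}"
    then have "meager {h \<in> S. f h > q}"
      by (rule meager_subset) (use q(1) in auto)
    with q(2) show False ..
  qed
next
  assume nm: "\<not> meager {h \<in> S. f h > 0}"
  have "{h \<in> S. f h > 0} \<subseteq> (\<Union>q\<in>{q \<in> \<rat>. 0 < q}. {h \<in> S. f h > q})"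
    using Rats_dense_in_real by fastforce
  moreover have "countable {q \<in> \<rat>. 0 < (q::real)}"
    using countable_rat by (rule countable_subset[rotated]) auto
  ultimately have "\<exists>q\<in>\<rat>. 0 < q \<and> \<not> meager {h \<in> S. f h > q}"
    using nm meager_subset[OF meager_UN[of "{q \<in> \<rat>. 0 < q}" "\<lambda>q. {h \<in> S. f h > q}"]]
    by (metis (mono_tags, lifting) mem_Collect_eq)
  then show "0 < category_sup S f"
    using assms less_category_sup_iff[of f 0 S] by simp
qed

text \<open>Where \<open>f\<close> exceeds \<open>c\<close>, \<open>f'\<close> exceeds
  \<open>c - w\<close>. Uniform closeness of bump functions thus becomes closeness of suprema, with
  a bound independent of \<open>S\<close>.\<close>

lemma category_sup_le_add:
  assumes "\<And>h. f h \<le> f' h + w" and "\<And>h. f h \<le> 1" "\<And>h. f' h \<le> 1" and "0 \<le> w"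
  shows "category_sup S f \<le> category_sup S f' + w"
  unfolding category_sup_def[of S f]
proof (rule cSup_least)
  fix c assume c: "c \<in> insert 0 {c. \<not> meager {h \<in> S. f h > c}}"
  show "c \<le> category_sup S f' + w"
  proof (cases "c = 0")
    case True
    then show ?thesis
      using category_sup_nonneg[of f' S] assms(3,4) by simp
  next
    case False
    with c have nm: "\<not> meager {h \<in> S. f h > c}"
      by simp
    have "\<not> meager {h \<in> S. f' h > c - w}"
    proof
      assume "meager {h \<in> S. f' h > c - w}"
      then have "meager {h \<in> S. f h > c}"
      proof (rule meager_subset, intro subsetI CollectI conjI)
        fix h assume "h \<in> {h \<in> S. f h > c}"
        then show "h \<in> S" "f' h > c - w"
          using assms(1)[of h] by auto
      qed
      with nm show False ..
    qed
    then show ?thesis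
      using category_sup_upper[of f' S "c - w"] assms(3) by simp
  qed
qed simp

text \<open>Translating the set and the function together translates every level set, and meagerness
  is translation invariant. Equivariance of the model rests on this.\<close>

lemma category_sup_translate:
  fixes S :: "'g::topological_group_add set"
  shows "category_sup ((\<lambda>h. h + a) -` S) (\<lambda>h. f (h + a)) = category_sup S f"
proof -
  have "meager {h \<in> (\<lambda>h. h + a) -` S. f (h + a) > c} \<longleftrightarrow> meager {h \<in> S. f h > c}" for c
    using meager_translate_iff[of a "{h \<in> S. f h > c}"] by (simp add: vimage_def)
  then show ?thesis
    unfolding category_sup_def by simp
qed

text \<open>At a level \<open>c \<ge> 0\<close>, the Montgomery--Novikov theorem is applied to the
  open sets \<open>{h. q < f h}\<close> with rational \<open>q > c\<close>.\<close>

lemma category_sup_measurable: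
  fixes N :: "'x measure" and B :: "('g::{t2_space, second_countable_topology} \<times> 'x) set"
  assumes lc: "locally_compact_space (euclidean :: 'g topology)"
    and B: "B \<in> sets (borel \<Otimes>\<^sub>M N)" and f: "continuous_on UNIV f" "\<And>h. f h \<le> 1"
  shows "(\<lambda>x. category_sup {h. (h, x) \<in> B} f) \<in> borel_measurable N"
  unfolding borel_measurable_iff_greater
proof
  fix c :: real
  show "{x \<in> space N. c < category_sup {h. (h, x) \<in> B} f} \<in> sets N"
  proof (cases "0 \<le> c")
    case True
    have "{x \<in> space N. c < category_sup {h. (h, x) \<in> B} f}
        = (\<Union>q\<in>{q \<in> \<rat>. c < q}. {x \<in> space N. \<not> meager ({h. q < f h} \<inter> {h. (h, x) \<in> B})})"
      by (auto simp: less_category_sup_iff[OF f(2) True] Int_def conj_commute)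
    moreover have "countable {q \<in> \<rat>. c < (q::real)}"
      using countable_rat by (rule countable_subset[rotated]) auto
    moreover have "open {h. q < f h}" for q
      using f(1) by (intro open_Collect_less) auto
    ultimately show ?thesis
      by (simp only:) (intro sets.countable_UN'' sets_nonmeager_sections[OF lc B])
  next
    case False
    then have "{x \<in> space N. c < category_sup {h. (h, x) \<in> B} f} = space N"
      using category_sup_nonneg[of f, OF f(2)] by (auto simp: not_le intro: less_le_trans[of c 0])
    then show ?thesis by simp
  qed
qed

section \<open>The shift action on equicontinuous functions\<close>

text \<open>The index \<open>p\<close> will code a pair of a measurable set and a bump function. The
  modulus sees only \<open>h - g\<close>, which is unchanged when both arguments are translated on
  the right.\<close>

definition equicontinuous_functions :: "(nat \<Rightarrow> 'g::group_add \<Rightarrow> real) \<Rightarrow> (nat \<Rightarrow> 'g \<Rightarrow> real) set" where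
  "equicontinuous_functions \<omega> =
     {u. \<forall>p g h. 0 \<le> u p g \<and> u p g \<le> 1 \<and> \<bar>u p g - u p h\<bar> \<le> \<omega> p (h - g)}"

lemma continuous_on_apply2: "continuous_on S (\<lambda>u :: 'p \<Rightarrow> 'g \<Rightarrow> real. u p g)"
  using continuous_on_product_then_coordinatewise[OF
      continuous_on_product_then_coordinatewise[OF continuous_on_id]] .

text \<open>Tychonoff for pointwise convergence: the conditions cut a closed set out of a product of
  unit intervals.\<close>

lemma compact_equicontinuous_functions: "compact (equicontinuous_functions \<omega>)"
proof -
  have box: "compact (PiE UNIV S)" if "\<And>i. compact (S i)" for S :: "'i \<Rightarrow> 'b::topological_space set"
    using that compactin_PiE[of "\<lambda>_. euclidean" UNIV S] by (simp add: euclidean_product_topology)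
  have "compact (PiE UNIV (\<lambda>p::nat. PiE UNIV (\<lambda>g::'a. {0..1::real})))"
    by (intro box compact_Icc)
  moreover have "closed (equicontinuous_functions \<omega>)"
    unfolding equicontinuous_functions_def
    by (intro closed_Collect_all closed_Collect_conj closed_Collect_le continuous_intros
        continuous_on_apply2)
  moreover have "equicontinuous_functions \<omega> \<subseteq> PiE UNIV (\<lambda>p::nat. PiE UNIV (\<lambda>g::'a. {0..1::real}))"
    unfolding equicontinuous_functions_def by auto
  ultimately show ?thesis
    by (metis compact_Int_closed inf.absorb_iff2)
qed

lemma equicontinuous_functions_shift:
  assumes "u \<in> equicontinuous_functions \<omega>"
  shows "(\<lambda>p h. u p (h + g)) \<in> equicontinuous_functions \<omega>"
proof -
  have "(h + g) - (h' + g) = h - h'" for h h'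
    by (simp add: diff_conv_add_uminus minus_add add.assoc del: add_uminus_conv_diff)
  then show ?thesis
    using assms unfolding equicontinuous_functions_def by (auto, metis)
qed

lemma tendsto_modulus:
  fixes \<omega> :: "'g::topological_group_add \<Rightarrow> real"
  assumes "(\<omega> \<longlongrightarrow> 0) (nhds 0)" and "(f \<longlongrightarrow> a) F"
  shows "((\<lambda>x. \<omega> (a - f x)) \<longlongrightarrow> 0) F"
proof -
  have "((\<lambda>x. a - f x) \<longlongrightarrow> a - a) F"
    by (intro tendsto_intros assms(2))
  then show ?thesis
    using filterlim_compose[OF assms(1)] by simp
qed

lemma continuous_equicontinuous_functions:
  fixes \<omega> :: "nat \<Rightarrow> 'g::topological_group_add \<Rightarrow> real"
  assumes "\<And>p. (\<omega> p \<longlongrightarrow> 0) (nhds 0)" and "u \<in> equicontinuous_functions \<omega>"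
  shows "continuous_on UNIV (u p)"
  unfolding continuous_on_def
proof
  fix a
  have "((\<lambda>x. u p x - u p a) \<longlongrightarrow> 0) (at a)"
  proof (rule Lim_null_comparison)
    show "\<forall>\<^sub>F x in at a. norm (u p x - u p a) \<le> \<omega> p (a - x)"
      using assms(2) unfolding equicontinuous_functions_def by auto
    show "((\<lambda>x. \<omega> p (a - x)) \<longlongrightarrow> 0) (at a)"
      by (intro tendsto_modulus assms tendsto_ident_at)
  qed
  then show "(u p \<longlongrightarrow> u p a) (at a)"
    by (simp add: LIM_zero_cancel)
qed

text \<open>The change of \<open>u p (h + g)\<close> splits in two: moving the argument costs at
  most \<open>\<omega>\<close>, uniformly in \<open>u\<close>, and moving \<open>u\<close> at a
  fixed argument is a coordinate evaluation.\<close>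

lemma continuous_on_shift:
  fixes \<omega> :: "nat \<Rightarrow> 'g::topological_group_add \<Rightarrow> real"
  assumes \<omega>: "\<And>p. (\<omega> p \<longlongrightarrow> 0) (nhds 0)"
  shows "continuous_on (UNIV \<times> equicontinuous_functions \<omega>) (\<lambda>(g, u). \<lambda>p h. u p (h + g))"
    (is "continuous_on ?S _")
  unfolding case_prod_unfold
proof (intro continuous_on_coordinatewise_then_product)
  fix p h
  show "continuous_on ?S (\<lambda>z. snd z p (h + fst z))"
    unfolding continuous_on_def
  proof
    fix z0 assume z0: "z0 \<in> ?S"
    have at: "(fst \<longlongrightarrow> fst z0) (at z0 within ?S)" "(snd \<longlongrightarrow> snd z0) (at z0 within ?S)"
      by (rule tendsto_fst[OF tendsto_ident_at] tendsto_snd[OF tendsto_ident_at])+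
    have "((\<lambda>z. snd z p (h + fst z) - snd z p (h + fst z0)) \<longlongrightarrow> 0) (at z0 within ?S)"
    proof (rule Lim_null_comparison)
      have "norm (snd z p (h + fst z) - snd z p (h + fst z0)) \<le> \<omega> p (h + fst z0 - (h + fst z))"
        if "z \<in> ?S" for z
        using that unfolding equicontinuous_functions_def by auto
      then show "\<forall>\<^sub>F z in at z0 within ?S. norm (snd z p (h + fst z) - snd z p (h + fst z0))
          \<le> \<omega> p (h + fst z0 - (h + fst z))"
        by (auto simp: eventually_at_filter intro: always_eventually)
      show "((\<lambda>z. \<omega> p (h + fst z0 - (h + fst z))) \<longlongrightarrow> 0) (at z0 within ?S)"
        by (intro tendsto_modulus \<omega> tendsto_intros at)
    qed
    moreover have "((\<lambda>z. snd z p (h + fst z0)) \<longlongrightarrow> snd z0 p (h + fst z0)) (at z0 within ?S)"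
      using continuous_on_compose2[OF continuous_on_apply2[of UNIV p "h + fst z0"] continuous_on_snd[OF continuous_on_id, of ?S]] z0
      unfolding continuous_on_def by auto
    ultimately show "((\<lambda>z. snd z p (h + fst z)) \<longlongrightarrow> snd z0 p (h + fst z0)) (at z0 within ?S)"
      using tendsto_add by fastforce
  qed
qed

text \<open>Equicontinuous functions are determined by their values on a dense sequence; this codes the
  compact function space into \<^typ>\<open>nat \<Rightarrow> real\<close>.\<close>

definition restrict_seq :: "(nat \<Rightarrow> 'g) \<Rightarrow> (nat \<Rightarrow> 'g \<Rightarrow> real) \<Rightarrow> nat \<Rightarrow> real" where
  "restrict_seq D u j = u (fst (prod_decode j)) (D (snd (prod_decode j)))"

lemma continuous_on_restrict_seq: "continuous_on S (restrict_seq D)"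
  unfolding restrict_seq_def[abs_def]
  by (intro continuous_on_coordinatewise_then_product continuous_on_apply2)

lemma inj_on_restrict_seq:
  fixes \<omega> :: "nat \<Rightarrow> 'g::topological_group_add \<Rightarrow> real"
  assumes \<omega>: "\<And>p. (\<omega> p \<longlongrightarrow> 0) (nhds 0)" and D: "closure (range D) = UNIV"
  shows "inj_on (restrict_seq D) (equicontinuous_functions \<omega>)"
proof (rule inj_onI)
  fix u v assume u: "u \<in> equicontinuous_functions \<omega>" and v: "v \<in> equicontinuous_functions \<omega>"
    and eq: "restrict_seq D u = restrict_seq D v"
  have "u p g = v p g" for p g
  proof -
    have "u p (D i) = v p (D i)" for i
      using fun_cong[OF eq, of "prod_encode (p, i)"] by (simp add: restrict_seq_def)
    then have "range D \<subseteq> {g. u p g = v p g}"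
      by auto
    moreover have "closed {g. u p g = v p g}"
      by (intro closed_Collect_eq continuous_equicontinuous_functions[of \<omega>] \<omega> u v)
    ultimately show ?thesis
      using D closure_minimal by blast
  qed
  then show "u = v" by blast
qed

text \<open>A continuous injection of a compact space into a Hausdorff space has a continuous
  inverse, so the shift transports to the coded functions. Shifting by \<open>h\<close> and then by
  \<open>g\<close> evaluates \<open>u\<close> at the argument plus \<open>g + h\<close>, hence a
  left action.\<close>

lemma compact_shift_action:
  fixes \<omega> :: "nat \<Rightarrow> 'g::topological_group_add \<Rightarrow> real"
  assumes \<omega>: "\<And>p. (\<omega> p \<longlongrightarrow> 0) (nhds 0)" and D: "closure (range D) = UNIV"
  obtains \<beta> where
    "continuous_action (top_of_set (restrict_seq D ` equicontinuous_functions \<omega>)) \<beta>"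
    "\<forall>g. \<forall>u\<in>equicontinuous_functions \<omega>.
       \<beta> g (restrict_seq D u) = restrict_seq D (\<lambda>p h. u p (h + g))"
proof -
  let ?L = "equicontinuous_functions \<omega>"
  let ?r = "restrict_seq D"
  define inv where "inv = the_inv_into ?L ?r"
  define \<beta> where "\<beta> g v = ?r (\<lambda>p h. inv v p (h + g))" for g v
  note inj = inj_on_restrict_seq[OF \<omega> D]
  have inv: "inv (?r u) = u" if "u \<in> ?L" for u
    unfolding inv_def using that inj by (simp add: the_inv_into_f_f)
  then have invL: "inv v \<in> ?L" if "v \<in> ?r ` ?L" for v
    using that by auto
  have \<beta>: "\<beta> g (?r u) = ?r (\<lambda>p h. u p (h + g))" if "u \<in> ?L" for g u
    using inv[OF that] by (simp add: \<beta>_def)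
  have "is_action_on (?r ` ?L) \<beta>"
    unfolding is_action_on_def
    using equicontinuous_functions_shift[of _ \<omega>] by (auto simp: \<beta> add.assoc)
  moreover have "continuous_on (UNIV \<times> ?r ` ?L) (\<lambda>(g, v). \<beta> g v)"
  proof -
    have "continuous_on (?r ` ?L) inv"
      unfolding inv_def
      by (intro continuous_on_inv_into continuous_on_restrict_seq compact_equicontinuous_functions inj)
    then have "continuous_on (UNIV \<times> ?r ` ?L) (\<lambda>z. (fst z :: 'g, inv (snd z)))"
      by (intro continuous_on_Pair continuous_on_fst continuous_on_compose2[of _ inv _ snd]
          continuous_on_snd continuous_on_id) auto
    then have "continuous_on (UNIV \<times> ?r ` ?L)
        (\<lambda>z. (case (fst z, inv (snd z)) of (g, u) \<Rightarrow> \<lambda>p h. u p (h + g)))"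
      by (rule continuous_on_compose2[OF continuous_on_shift[OF \<omega>]]) (auto simp: inv)
    then have "continuous_on (UNIV \<times> ?r ` ?L)
        (\<lambda>z. ?r (case (fst z, inv (snd z)) of (g, u) \<Rightarrow> \<lambda>p h. u p (h + g)))"
      by (rule continuous_on_compose2[OF continuous_on_restrict_seq[of UNIV D]]) auto
    then show ?thesis
      by (simp add: \<beta>_def case_prod_unfold)
  qed
  then have "continuous_map (top_of_set (UNIV \<times> ?r ` ?L)) (top_of_set (?r ` ?L)) (\<lambda>(g, v). \<beta> g v)"
    using \<open>is_action_on _ \<beta>\<close> by (auto simp: continuous_map_in_subtopology is_action_on_def)
  then have "continuous_map (prod_topology euclidean (top_of_set (?r ` ?L))) (top_of_set (?r ` ?L))
      (\<lambda>(g, v). \<beta> g v)"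
    using prod_topology_subtopology_eu[of "UNIV :: 'g set" "?r ` ?L"] by (simp only: subtopology_UNIV)
  ultimately show ?thesis
    using that[of \<beta>] \<beta> by (simp add: continuous_action_def)
qed

section \<open>Standard Borel spaces\<close>

lemma space_borel_of: "space (borel_of T) = topspace T"
  unfolding borel_of_def by (rule space_measure_of) (auto dest: openin_subset)

lemma sets_borel_of: "sets (borel_of T) = sigma_sets (topspace T) {U. openin T U}"
  unfolding borel_of_def by (rule sets_measure_of) (auto dest: openin_subset)

lemma continuous_map_measurable_borel_of:
  assumes "continuous_map S T f"
  shows "f \<in> measurable (borel_of S) (borel_of T)"
proof (rule measurable_sigma_sets[OF sets_borel_of])
  show "{U. openin T U} \<subseteq> Pow (topspace T)"
    by (auto dest: openin_subset)
  show "f \<in> space (borel_of S) \<rightarrow> topspace T"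
    using assms by (auto simp: space_borel_of continuous_map_def)
  fix U assume "U \<in> {U. openin T U}"
  then have "openin S {x \<in> topspace S. f x \<in> U}"
    using assms by (simp add: continuous_map_def)
  moreover have "f -` U \<inter> space (borel_of S) = {x \<in> topspace S. f x \<in> U}"
    by (auto simp: space_borel_of)
  ultimately show "f -` U \<inter> space (borel_of S) \<in> sets (borel_of S)"
    by (auto simp: sets_borel_of)
qed

lemma sets_borel_of_top_of_set:
  assumes "K \<in> sets borel"
  shows "sets (borel_of (top_of_set K)) = sets (restrict_space borel K)"
proof -
  have "sets (restrict_space borel K) = (\<inter>) K ` sigma_sets UNIV {U. open U}"
    by (simp add: sets_restrict_space sets_borel)
  also have "\<dots> = sigma_sets K ((\<inter>) K ` {U. open U})"
    using assms by (intro sigma_sets_Int) (auto simp: sets_borel)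
  also have "(\<inter>) K ` {U. open U} = {U. openin (top_of_set K) U}"
    by (auto simp: openin_open)
  finally show ?thesis
    by (simp add: sets_borel_of)
qed

text \<open>The image of \<open>S\<close> is its preimage under the inverse of \<open>f\<close>,
  which is continuous because \<open>C\<close> is compact.\<close>

lemma inj_on_image_borel:
  fixes f :: "'a::t2_space \<Rightarrow> 'b::t2_space"
  assumes C: "compact C" and f: "continuous_on C f" "inj_on f C"
    and S: "S \<in> sets borel" "S \<subseteq> C"
  shows "f ` S \<in> sets borel"
proof -
  define g where "g = the_inv_into C f"
  have "continuous_on (f ` C) g"
    unfolding g_def using C f by (intro continuous_on_inv_into)
  then have "g -` S \<inter> space (restrict_space borel (f ` C)) \<in> sets (restrict_space borel (f ` C))"
    using S(1) by (intro measurable_sets[OF borel_measurable_continuous_on_restrict])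
  moreover have "g -` S \<inter> space (restrict_space borel (f ` C)) = f ` S"
    using S(2) f(2) by (auto simp: g_def space_restrict_space the_inv_into_f_f image_iff subset_iff)
  moreover have "f ` C \<in> sets borel"
    using compact_continuous_image[OF f(1) C] compact_imp_closed by (intro borel_closed) blast
  ultimately show ?thesis
    by (simp add: sets_restrict_space_iff)
qed

text \<open>\<open>e\<close> sends a point to its distances from a dense sequence, for a complete
  metric behind the Borel structure. Completeness makes the image of the whole space Borel.\<close>

lemma standard_probability_space_embedding:
  fixes M :: "'x measure"
  assumes "standard_probability_space M"
  obtains e :: "'x \<Rightarrow> nat \<Rightarrow> real" where "e \<in> borel_measurable M" "inj_on e (space M)"
    "\<And>A. A \<in> sets M \<Longrightarrow> e ` A \<in> sets borel"
proof -
  interpret prob_space M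
    using assms by (simp add: standard_probability_space_def)
  obtain X d where Xd: "Metric_space X d" "Metric_space.mcomplete X d"
    and sep: "separable_space (Metric_space.mtopology X d)"
    and sets: "sets M = sets (borel_of (Metric_space.mtopology X d))"
    using assms unfolding standard_probability_space_def completely_metrizable_space_def by blast
  interpret Metric_space X d by (rule Xd(1))
  have spX: "space M = X"
    using sets_eq_imp_space_eq[OF sets] by (simp add: space_borel_of)
  have openM: "U \<in> sets M" if "openin mtopology U" for U
    using that by (auto simp: sets sets_borel_of)
  obtain Q where Q: "countable Q" "Q \<subseteq> X" "mtopology closure_of Q = X"
    using sep unfolding separable_space_def by auto
  have "Q \<noteq> {}"
    using Q(3) not_empty spX by auto
  define q where "q = from_nat_into Q"
  have qX: "q i \<in> X" for i
    using subsetD[OF Q(2) from_nat_into[OF \<open>Q \<noteq> {}\<close>]] by (simp add: q_def)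
  have dense: "\<exists>i. d x (q i) < r" if "x \<in> X" "r > 0" for x r
  proof -
    have "x \<in> mtopology closure_of Q" using Q(3) that by simp
    moreover have "x \<in> mball x r" "openin mtopology (mball x r)"
      using that by simp_all
    ultimately obtain y where y: "y \<in> Q" "y \<in> mball x r"
      unfolding in_closure_of by blast
    obtain i where "q i = y"
      using from_nat_into_surj[OF Q(1) y(1)] unfolding q_def by blast
    with y(2) show ?thesis by auto
  qed
  define e where "e x i = d x (q i)" for x i
  have meas: "e \<in> borel_measurable M"
  proof (intro measurable_coordinatewise_then_product)
    fix i
    have "{x \<in> space M. e x i < c} = mball (q i) c" for c
      using qX by (auto simp: e_def spX commute)
    then show "(\<lambda>x. e x i) \<in> borel_measurable M"
      unfolding borel_measurable_iff_less by (auto intro: openM)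
  qed
  have inj: "inj_on e (space M)"
  proof (rule inj_onI)
    fix x y assume xy: "x \<in> space M" "y \<in> space M" "e x = e y"
    have "d x y < r" if r: "r > 0" for r
    proof -
      obtain i where i: "d x (q i) < r / 2"
        using dense[of x "r / 2"] xy r spX by auto
      moreover have "d y (q i) = d x (q i)"
        using fun_cong[OF xy(3), of i] by (simp add: e_def)
      ultimately show ?thesis
        using triangle[of x "q i" y] qX[of i] xy spX by (simp add: commute)
    qed
    then have "d x y \<le> 0"
      by (meson less_irrefl not_le)
    then show "x = y"
      using xy spX nonneg[of x y] zero by fastforce
  qed
  \<comment> \<open>A point \<open>v\<close> of the closure is a limit of some
    \<open>e (x n)\<close>. It is attained once its coordinates become arbitrarily small: a small
    \<open>v i\<close> puts almost all \<open>x n\<close> near \<open>q i\<close>, so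
    \<open>x\<close> is Cauchy.\<close>
  have image_X: "e ` X = closure (e ` X) \<inter> (\<Inter>n. \<Union>i. {v. v i < inverse (real (Suc n))})"
    (is "_ = ?R")
  proof
    show "e ` X \<subseteq> ?R"
      using dense closure_subset[of "e ` X"] by (auto simp: e_def)
    show "?R \<subseteq> e ` X"
    proof
      fix v assume v: "v \<in> ?R"
      then obtain s where s: "\<forall>n. s n \<in> e ` X" "s \<longlonglongrightarrow> v"
        using closure_sequential[of v "e ` X"] by blast
      then have "\<forall>n. \<exists>y. y \<in> X \<and> s n = e y"
        by blast
      then obtain x where x: "\<And>n. x n \<in> X" "\<And>n. s n = e (x n)"
        using choice[of "\<lambda>n y. y \<in> X \<and> s n = e y"] by blast
      have coord: "(\<lambda>n. d (x n) (q i)) \<longlonglongrightarrow> v i" for i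
      proof -
        have "isCont (\<lambda>v::nat \<Rightarrow> real. v i) v"
          by (rule continuous_on_interior[OF continuous_on_product_coordinates]) simp
        then have "(\<lambda>n. s n i) \<longlonglongrightarrow> v i"
          using s(2) by (rule isCont_tendsto_compose)
        then show ?thesis by (simp add: x(2) e_def)
      qed
      have "MCauchy x"
        unfolding MCauchy_def
      proof (intro conjI allI impI)
        show "range x \<subseteq> X" using x(1) by blast
        fix \<epsilon> :: real assume "\<epsilon> > 0"
        then obtain n where n: "inverse (real (Suc n)) < \<epsilon> / 2"
          using reals_Archimedean[of "\<epsilon> / 2"] by auto
        moreover obtain i where "v i < inverse (real (Suc n))"
          using v by blast
        ultimately have "\<forall>\<^sub>F n in sequentially. d (x n) (q i) < \<epsilon> / 2"
          by (intro order_tendstoD(2)[OF coord[of i]]) linarith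
        then obtain N where N: "\<And>n. n \<ge> N \<Longrightarrow> d (x n) (q i) < \<epsilon> / 2"
          by (auto simp: eventually_sequentially)
        have "d (x n) (x n') < \<epsilon>" if "N \<le> n" "N \<le> n'" for n n'
          using N[OF that(1)] N[OF that(2)] triangle[of "x n" "q i" "x n'"] x(1) qX
          by (simp add: commute)
        then show "\<exists>N. \<forall>n n'. N \<le> n \<longrightarrow> N \<le> n' \<longrightarrow> d (x n) (x n') < \<epsilon>" by blast
      qed
      then obtain l where l: "l \<in> X" "(\<lambda>n. d (x n) l) \<longlonglongrightarrow> 0"
        using Xd(2) unfolding mcomplete_def limitin_metric_dist_null by blast
      have "e l i = v i" for i
      proof (rule LIMSEQ_unique[OF _ coord])
        have "(\<lambda>n. d (x n) (q i) - d l (q i)) \<longlonglongrightarrow> 0"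
        proof (rule Lim_null_comparison[OF always_eventually l(2)], rule allI)
          fix n
          show "norm (d (x n) (q i) - d l (q i)) \<le> d (x n) l"
            using triangle[of "x n" l "q i"] triangle[of l "x n" "q i"] x(1)[of n] l(1) qX[of i]
            by (simp add: commute abs_le_iff)
        qed
        then show "(\<lambda>n. d (x n) (q i)) \<longlonglongrightarrow> e l i"
          by (simp add: e_def LIM_zero_cancel)
      qed
      then have "e l = v" by blast
      then show "v \<in> e ` X" using l(1) by blast
    qed
  qed
  have coord_open: "open {v :: nat \<Rightarrow> real. v i < c}" for i c
    by (intro open_Collect_less continuous_on_product_coordinates continuous_on_const)
  have borel_X: "e ` X \<in> sets borel"
    by (subst image_X) (intro sets.Int sets.countable_INT'' borel_open open_UN coord_open borel_closed
        closed_closure ballI, auto)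
  have borel_open: "e ` U \<in> sets borel" if U: "openin mtopology U" for U
  proof -
    have "U \<subseteq> X" using openin_subset[OF U] by simp
    \<comment> \<open>On points of the image, \<open>v i < s\<close> means lying in the ball of
      radius \<open>s\<close> about \<open>q i\<close>; by density such balls exhaust
      \<open>U\<close>.\<close>
    define O' where "O' = (\<Union>(i, s)\<in>{(i, s). mball (q i) s \<subseteq> U}. {v. v i < s})"
    have "e ` U = e ` X \<inter> O'"
    proof (intro set_eqI iffI)
      fix v assume "v \<in> e ` U"
      then obtain x where x: "x \<in> U" "v = e x" by blast
      then obtain r where r: "r > 0" "mball x r \<subseteq> U"
        using U unfolding openin_mtopology by blast
      obtain i where i: "d x (q i) < r / 2"
        using dense[of x "r / 2"] r(1) x(1) \<open>U \<subseteq> X\<close> by auto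
      have "mball (q i) (r / 2) \<subseteq> mball x r"
      proof
        fix y assume y: "y \<in> mball (q i) (r / 2)"
        then show "y \<in> mball x r"
          using triangle[of x "q i" y] i x(1) \<open>U \<subseteq> X\<close> by auto
      qed
      then show "v \<in> e ` X \<inter> O'"
        using r(2) x i \<open>U \<subseteq> X\<close> unfolding O'_def e_def by fast
    next
      fix v assume v: "v \<in> e ` X \<inter> O'"
      then obtain y i s where "y \<in> X" "v = e y" "mball (q i) s \<subseteq> U" "v i < s"
        unfolding O'_def by auto
      moreover from this have "y \<in> mball (q i) s"
        using qX by (simp add: e_def commute)
      ultimately show "v \<in> e ` U" by blast
    qed
    moreover have "open O'"
      unfolding O'_def by (auto intro!: open_UN coord_open)
    ultimately show ?thesis
      using borel_X by auto
  qed
  have "e ` A \<in> sets borel" if "A \<in> sets M" for A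
  proof -
    have "A \<in> sigma_sets X {U. openin mtopology U}"
      using that by (simp add: sets sets_borel_of)
    then show ?thesis
    proof induction
      case (Compl A)
      have "A \<subseteq> X"
        using sigma_sets_into_sp[OF _ Compl(1)] openin_subset by fastforce
      then have "e ` (X - A) = e ` X - e ` A"
        using inj spX inj_on_image_set_diff[of e X X A] by auto
      then show ?case
        using Compl borel_X by auto
    qed (auto simp: borel_open image_UN)
  qed
  then show ?thesis
    using that meas inj by blast
qed

text \<open>Substitutes for the Lusin--Souslin theorem: the graph of \<open>\<phi>\<close> is exhausted, up to a null set,
  by compact sets, and both coordinate projections are homeomorphisms on each of them.\<close>

lemma bimeasurable_on_conull_set:
  fixes M :: "'x measure" and e :: "'x \<Rightarrow> nat \<Rightarrow> real" and \<phi> :: "'x \<Rightarrow> nat \<Rightarrow> real"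
  assumes M: "prob_space M" and e: "e \<in> borel_measurable M" "inj_on e (space M)"
    "\<And>A. A \<in> sets M \<Longrightarrow> e ` A \<in> sets borel"
    and \<phi>: "\<phi> \<in> borel_measurable M" "inj_on \<phi> (space M)"
  obtains A where "A \<in> sets M" "space M - A \<in> null_sets M"
    "\<And>S. S \<in> sets M \<Longrightarrow> S \<subseteq> A \<Longrightarrow> \<phi> ` S \<in> sets borel"
proof -
  interpret prob_space M by fact
  define pair where "pair x = (e x, \<phi> x)" for x
  have pair: "pair \<in> borel_measurable M"
    unfolding pair_def using e(1) \<phi>(1) by (intro borel_measurable_Pair)
  define \<Gamma> where "\<Gamma> = pair ` space M"
  \<comment> \<open>\<open>\<Gamma>\<close> is the graph of \<open>\<psi>\<close>, which is
    \<open>\<phi>\<close> after the inverse of \<open>e\<close>, over the Borel image of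
    \<open>e\<close>.\<close>
  have "\<Gamma> \<in> sets borel"
  proof -
    \<comment> \<open>Off the image of \<open>e\<close> the value is constant, so it adds all or
      nothing of a Borel set to each preimage.\<close>
    define \<psi> where "\<psi> v = (if v \<in> e ` space M then \<phi> (the_inv_into (space M) e v) else undefined)" for v
    have \<psi>e: "\<psi> (e x) = \<phi> x" if "x \<in> space M" for x
      using that e(2) by (simp add: \<psi>_def the_inv_into_f_f)
    have "\<psi> \<in> borel_measurable borel"
    proof (rule measurableI)
      fix B :: "(nat \<Rightarrow> real) set" assume B: "B \<in> sets borel"
      have "\<psi> -` B \<inter> space borel
          = e ` (\<phi> -` B \<inter> space M) \<union> (if undefined \<in> B then - e ` space M else {})"
        using \<psi>e by (auto simp: \<psi>_def split: if_splits)
      moreover have "\<phi> -` B \<inter> space M \<in> sets M"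
        using \<phi>(1) B by (rule measurable_sets)
      ultimately show "\<psi> -` B \<inter> space borel \<in> sets borel"
        using e(3) by (auto simp: borel_comp)
    qed simp
    then have "{z \<in> space borel. \<psi> (fst z) = snd z} \<in> sets borel"
      by (intro measurable_equality_set)
        (auto simp: borel_prod[symmetric] intro: measurable_compose[OF measurable_fst])
    moreover have "e ` space M \<times> UNIV \<in> sets (borel :: ((nat \<Rightarrow> real) \<times> (nat \<Rightarrow> real)) measure)"
      using e(3)[OF sets.top] by (simp flip: borel_prod add: pair_measureI)
    moreover have "\<Gamma> = {z \<in> space borel. \<psi> (fst z) = snd z} \<inter> (e ` space M \<times> UNIV)"
      using \<psi>e by (auto simp: \<Gamma>_def pair_def)
    ultimately show ?thesis by auto
  qed
  define \<rho> where "\<rho> = distr M borel pair"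
  interpret \<rho>: prob_space \<rho>
    unfolding \<rho>_def using pair by (rule prob_space_distr)
  have \<rho>: "emeasure \<rho> B = emeasure M (pair -` B \<inter> space M)" if "B \<in> sets borel" for B
    unfolding \<rho>_def using pair that by (rule emeasure_distr)
  have "pair -` \<Gamma> \<inter> space M = space M"
    by (auto simp: \<Gamma>_def)
  then have "emeasure \<rho> \<Gamma> = 1"
    using \<open>\<Gamma> \<in> sets borel\<close> \<rho>[of \<Gamma>] emeasure_space_1 by simp
  \<comment> \<open>Inner regularity by compact sets of a finite Borel measure on a Polish
    space.\<close>
  moreover have "emeasure \<rho> \<Gamma> = (SUP C\<in>{C. C \<subseteq> \<Gamma> \<and> compact C}. emeasure \<rho> C)"
    using \<open>\<Gamma> \<in> sets borel\<close> \<rho>.emeasure_finite by (intro inner_regular) (simp_all add: \<rho>_def)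
  ultimately have "(SUP C\<in>{C. C \<subseteq> \<Gamma> \<and> compact C}. emeasure \<rho> C) = 1"
    by simp
  moreover have "ennreal (1 - inverse (real (Suc n))) < 1" for n
    by (simp add: ennreal_less_one_iff)
  ultimately have "\<exists>C. C \<subseteq> \<Gamma> \<and> compact C \<and> ennreal (1 - inverse (real (Suc n))) < emeasure \<rho> C" for n
    by (metis (mono_tags, lifting) less_SUP_iff mem_Collect_eq)
  then obtain C where C: "\<And>n. C n \<subseteq> \<Gamma>" "\<And>n. compact (C n)"
    "\<And>n. ennreal (1 - inverse (real (Suc n))) < emeasure \<rho> (C n)"
    by metis
  have Cb: "C n \<in> sets borel" for n
    using C(2) compact_imp_closed by (intro borel_closed) blast
  \<comment> \<open>Each \<open>C n\<close> contributes a preimage of measure above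
    \<open>1 - inverse (real (Suc n))\<close>, so \<open>A\<close> has full measure.\<close>
  define A where "A = (\<Union>n. pair -` C n \<inter> space M)"
  have An: "pair -` C n \<inter> space M \<in> sets M" for n
    using pair Cb by (rule measurable_sets)
  then have A: "A \<in> sets M"
    unfolding A_def by (intro sets.countable_UN) auto
  have "1 - inverse (real (Suc n)) \<le> prob A" for n
  proof -
    have "emeasure \<rho> (C n) \<le> emeasure M A"
      using A An unfolding \<rho>[OF Cb] A_def by (intro emeasure_mono) auto
    from less_le_trans[OF C(3) this]
    have "ennreal (1 - inverse (real (Suc n))) \<le> ennreal (prob A)"
      unfolding emeasure_eq_measure by (rule less_imp_le)
    then show ?thesis
      using ennreal_le_iff[OF measure_nonneg] by blast
  qed
  then have "\<not> inverse (real (Suc n)) < 1 - prob A" for n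
    by (metis add.commute diff_less_eq not_le less_diff_eq)
  then have "\<not> 0 < 1 - prob A"
    using reals_Archimedean by blast
  then have "prob A = 1"
    using prob_le_1[of A] by linarith
  then have "space M - A \<in> null_sets M"
    using A by (auto simp: prob_compl emeasure_eq_measure intro!: null_setsI)
  moreover have "\<phi> ` S \<in> sets borel" if S: "S \<in> sets M" "S \<subseteq> A" for S
  proof -
    \<comment> \<open>On \<open>C n\<close> the projection \<open>snd\<close> is injective because
      \<open>\<phi>\<close> is, and the points of \<open>C n\<close> over \<open>S\<close> form a
      Borel set because \<open>e\<close> maps \<open>S\<close> to a Borel set.\<close>
    have "\<phi> ` (S \<inter> (pair -` C n \<inter> space M)) \<in> sets borel" for n
    proof -
      have "inj_on snd \<Gamma>"
        using \<phi>(2) by (auto simp: inj_on_def \<Gamma>_def pair_def)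
      then have "inj_on snd (C n)"
        using C(1) by (rule inj_on_subset)
      moreover have "C n \<inter> (e ` S \<times> UNIV) \<in> sets borel"
        using Cb[of n] e(3)[OF S(1)] by (simp flip: borel_prod add: pair_measureI sets.Int)
      ultimately have "snd ` (C n \<inter> (e ` S \<times> UNIV)) \<in> sets borel"
        using C(2)[of n] by (intro inj_on_image_borel[of "C n"] continuous_intros) auto
      moreover have "snd ` (C n \<inter> (e ` S \<times> UNIV)) = \<phi> ` (S \<inter> (pair -` C n \<inter> space M))"
        (is "?l = ?r")
      proof
        show "?l \<subseteq> ?r"
        proof
          fix w assume "w \<in> ?l"
          then obtain y where y: "y \<in> S" "(e y, w) \<in> C n" by auto
          then obtain x where x: "x \<in> space M" "e y = e x" "w = \<phi> x"
            using C(1)[of n] by (auto simp: \<Gamma>_def pair_def)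
          moreover have "y \<in> space M" using y S sets.sets_into_space by blast
          ultimately have "x = y" using e(2) by (auto dest: inj_onD)
          then show "w \<in> ?r" using x y by (auto simp: pair_def)
        qed
        show "?r \<subseteq> ?l" by (force simp: pair_def)
      qed
      ultimately show ?thesis by simp
    qed
    moreover have "\<phi> ` S = (\<Union>n. \<phi> ` (S \<inter> (pair -` C n \<inter> space M)))"
      using S(2) unfolding A_def by blast
    ultimately show ?thesis by auto
  qed
  ultimately show ?thesis
    using that A by blast
qed

section \<open>The compact model\<close>

text \<open>\<open>S m\<close> and \<open>T m\<close> stand for the times at which two points visit
  the \<open>m\<close>-th measurable set. Some difference is non-meager, hence comeager in an open
  \<open>U\<close>; a bump vanishing off \<open>U\<close> has positive supremum over
  \<open>S m\<close> and supremum 0 over \<open>T m\<close>.\<close>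

lemma category_sup_separates:
  fixes S T :: "'i::countable \<Rightarrow> 'g::{topological_group_add, t2_space} set"
  assumes lc: "locally_compact_space (euclidean :: 'g topology)"
    and bp: "\<And>m. baire_property (S m)" "\<And>m. baire_property (T m)"
    and cover: "(\<Union>m. S m - T m) = UNIV"
    and V: "\<And>U. open U \<Longrightarrow> 0 \<in> U \<Longrightarrow> \<exists>n. V n \<subseteq> U"
    and k: "\<And>n. continuous_on UNIV (k n)" "\<And>n h. k n h \<le> 1" "\<And>n. k n 0 = 1"
      "\<And>n h. h \<notin> V n \<Longrightarrow> k n h = 0"
  shows "\<exists>m n g. category_sup (S m) (\<lambda>h. k n (h - g)) \<noteq> category_sup (T m) (\<lambda>h. k n (h - g))"
proof -
  have "\<not> meager (\<Union>m. S m - T m)"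
    using open_not_meager[OF lc open_UNIV UNIV_not_empty] cover by simp
  then obtain m where m: "\<not> meager (S m - T m)"
    using meager_UN[of UNIV "\<lambda>m. S m - T m"] by auto
  have "baire_property (S m - T m)"
    using bp baire_property_Int[OF bp(1) baire_property_Compl[OF bp(2)]] by (simp add: Diff_eq)
  then obtain U where U: "open U" "U \<noteq> {}" "meager (U - (S m - T m))"
    using m by (rule baire_property_comeager_in_open)
  then obtain g where g: "g \<in> U" by blast
  \<comment> \<open>Moving \<open>U\<close> to a neighbourhood of the identity makes
    \<open>k n\<close>, recentred at \<open>g\<close>, vanish outside \<open>U\<close>.\<close>
  have "open ((\<lambda>s. s + g) -` U)" "0 \<in> (\<lambda>s. s + g) -` U"
    using U(1) g by (auto intro!: open_vimage continuous_intros)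
  then obtain n where n: "V n \<subseteq> (\<lambda>s. s + g) -` U"
    using V by blast
  have supp: "h \<in> U" if "0 < k n (h - g)" for h
  proof -
    have "h - g \<in> V n" using k(4)[of "h - g" n] that by fastforce
    with n have "h - g + g \<in> U" by blast
    then show ?thesis by simp
  qed
  have "meager {h \<in> T m. 0 < k n (h - g)}"
    by (rule meager_subset[OF U(3)]) (use supp in auto)
  moreover have "\<not> meager {h \<in> S m. 0 < k n (h - g)}"
  proof
    assume "meager {h \<in> S m. 0 < k n (h - g)}"
    from meager_Un[OF this U(3)] have "meager {h. 0 < k n (h - g)}"
      by (rule meager_subset) (use supp in auto)
    moreover have "open {h. 0 < k n (h - g)}"
      by (intro open_Collect_less continuous_on_compose2[OF k(1)])
        (auto simp: diff_conv_add_uminus simp del: add_uminus_conv_diff intro!: continuous_intros)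
    moreover have "g \<in> {h. 0 < k n (h - g)}"
      using k(3) by simp
    ultimately show False
      using open_not_meager[OF lc] by blast
  qed
  ultimately have "category_sup (S m) (\<lambda>h. k n (h - g)) \<noteq> category_sup (T m) (\<lambda>h. k n (h - g))"
    using category_sup_pos_iff[of "\<lambda>h. k n (h - g)"] k(2) by metis
  then show ?thesis by blast
qed

text \<open>The modulus is the uniform distance between \<open>k\<close> and its right translate by
  \<open>s\<close>; the bounds on \<open>k\<close> make this supremum finite.\<close>

lemma sup_translation_distance_tendsto:
  fixes k :: "'g::topological_group_add \<Rightarrow> real"
  assumes "\<And>h. 0 \<le> k h" "\<And>h. k h \<le> 1"
    and "\<And>\<epsilon>. \<epsilon> > 0 \<Longrightarrow> \<exists>W. open W \<and> 0 \<in> W \<and> (\<forall>s\<in>W. \<forall>h. \<bar>k (h + s) - k h\<bar> \<le> \<epsilon>)"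
  shows "((\<lambda>s. SUP h. \<bar>k (h + s) - k h\<bar>) \<longlongrightarrow> 0) (nhds 0)"
    and "\<bar>k (h + s) - k h\<bar> \<le> (SUP h. \<bar>k (h + s) - k h\<bar>)"
proof -
  have bdd: "bdd_above (range (\<lambda>h. \<bar>k (h + s) - k h\<bar>))" for s
  proof (rule bdd_aboveI2)
    fix h show "\<bar>k (h + s) - k h\<bar> \<le> 1"
      using assms(1,2)[of h] assms(1,2)[of "h + s"] by simp
  qed
  show le: "\<bar>k (h + s) - k h\<bar> \<le> (SUP h. \<bar>k (h + s) - k h\<bar>)" for h s
    using bdd by (rule cSUP_upper2) auto
  show "((\<lambda>s. SUP h. \<bar>k (h + s) - k h\<bar>) \<longlongrightarrow> 0) (nhds 0)"
  proof (rule tendstoI)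
    fix \<epsilon> :: real assume "\<epsilon> > 0"
    then obtain W where W: "open W" "0 \<in> W" "\<forall>s\<in>W. \<forall>h. \<bar>k (h + s) - k h\<bar> \<le> \<epsilon> / 2"
      using assms(3)[of "\<epsilon> / 2"] by auto
    have "dist (SUP h. \<bar>k (h + s) - k h\<bar>) 0 < \<epsilon>" if "s \<in> W" for s
    proof -
      have "(SUP h. \<bar>k (h + s) - k h\<bar>) \<le> \<epsilon> / 2"
        using W(3) that by (intro cSUP_least) auto
      moreover have "0 \<le> (SUP h. \<bar>k (h + s) - k h\<bar>)"
        using le[of 0 s] by linarith
      ultimately show ?thesis using \<open>\<epsilon> > 0\<close> by simp
    qed
    then show "\<forall>\<^sub>F s in nhds 0. dist (SUP h. \<bar>k (h + s) - k h\<bar>) 0 < \<epsilon>"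
      using W by (auto simp: eventually_nhds)
  qed
qed

text \<open>Equivariance and injectivity are obtained at every point of \<open>space M\<close>, not
  merely almost everywhere. The map \<open>e\<close> supplies a countable family of measurable sets
  separating points.\<close>

lemma borel_action_equivariant_embedding:
  fixes M :: "'x measure" and act :: "'g::{topological_group_add, t2_space, second_countable_topology} \<Rightarrow> 'x \<Rightarrow> 'x"
    and e :: "'x \<Rightarrow> nat \<Rightarrow> real"
  assumes lc: "locally_compact_space (euclidean :: 'g topology)"
    and act: "measurable_action M act"
    and e: "e \<in> borel_measurable M" "inj_on e (space M)"
  obtains K :: "(nat \<Rightarrow> real) set" and \<beta> \<phi> where "compact K" "continuous_action (top_of_set K) \<beta>"
    "\<phi> \<in> borel_measurable M" "inj_on \<phi> (space M)" "\<phi> ` space M \<subseteq> K"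
    "\<And>g x. x \<in> space M \<Longrightarrow> \<phi> (act g x) = \<beta> g (\<phi> x)"
proof -
  have action: "is_action_on (space M) act" and act_meas: "(\<lambda>(g, x). act g x) \<in> measurable (borel \<Otimes>\<^sub>M M) M"
    using act by (auto simp: measurable_action_def)
  obtain V :: "nat \<Rightarrow> 'g set" where V: "\<And>n. open (V n)" "\<And>n. 0 \<in> V n"
    "\<And>U. open U \<Longrightarrow> 0 \<in> U \<Longrightarrow> eventually (\<lambda>n. V n \<subseteq> U) sequentially"
    using countable_basis_at_decseq[of 0] by metis
  have "\<forall>n. \<exists>k :: 'g \<Rightarrow> real. (\<forall>h. 0 \<le> k h) \<and> (\<forall>h. k h \<le> 1) \<and> continuous_on UNIV k \<and> k 0 = 1 \<and>
      (\<forall>h. h \<notin> V n \<longrightarrow> k h = 0) \<and>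
      (\<forall>\<epsilon>>0. \<exists>W. open W \<and> 0 \<in> W \<and> (\<forall>s\<in>W. \<forall>h. \<bar>k (h + s) - k h\<bar> \<le> \<epsilon>))"
  proof
    fix n
    show "\<exists>k :: 'g \<Rightarrow> real. (\<forall>h. 0 \<le> k h) \<and> (\<forall>h. k h \<le> 1) \<and> continuous_on UNIV k \<and> k 0 = 1 \<and>
      (\<forall>h. h \<notin> V n \<longrightarrow> k h = 0) \<and>
      (\<forall>\<epsilon>>0. \<exists>W. open W \<and> 0 \<in> W \<and> (\<forall>s\<in>W. \<forall>h. \<bar>k (h + s) - k h\<bar> \<le> \<epsilon>))"
      by (rule exists_uniformly_continuous_bump[OF lc V(1)[of n] V(2)[of n]]) blast
  qed
  then obtain k :: "nat \<Rightarrow> 'g \<Rightarrow> real" where k: "\<And>n h. 0 \<le> k n h" "\<And>n h. k n h \<le> 1"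
    "\<And>n. continuous_on UNIV (k n)" "\<And>n. k n 0 = 1" "\<And>n h. h \<notin> V n \<Longrightarrow> k n h = 0"
    "\<And>n \<epsilon>. \<epsilon> > 0 \<Longrightarrow> \<exists>W. open W \<and> 0 \<in> W \<and> (\<forall>s\<in>W. \<forall>h. \<bar>k n (h + s) - k n h\<bar> \<le> \<epsilon>)"
    by (metis (no_types))
  obtain \<B> :: "(nat \<Rightarrow> real) set set" where \<B>: "countable \<B>" "topological_basis \<B>"
    using ex_countable_basis by blast
  have "\<B> \<noteq> {}"
    using topological_basisE[OF \<B>(2) open_UNIV UNIV_I] by blast
  define A where "A m = e -` from_nat_into \<B> m \<inter> space M" for m
  have A: "A m \<in> sets M" for m
    unfolding A_def using \<B>(2) from_nat_into[OF \<open>\<B> \<noteq> {}\<close>]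
    by (intro measurable_sets[OF e(1)] borel_open topological_basis_open)
  have sep: "\<exists>m. x \<in> A m \<and> y \<notin> A m" if xy: "x \<in> space M" "y \<in> space M" "x \<noteq> y" for x y
  proof -
    have "e x \<noteq> e y" using e(2) xy by (auto dest: inj_onD)
    then obtain B where B: "B \<in> \<B>" "e x \<in> B" "B \<subseteq> - {e y}"
      using topological_basisE[OF \<B>(2), of "- {e y}" "e x"] by auto
    obtain m where "from_nat_into \<B> m = B"
      using from_nat_into_surj[OF \<B>(1) B(1)] by blast
    then show ?thesis using B xy by (auto simp: A_def)
  qed
  obtain D :: "'g set" where D: "countable D" "\<And>U. open U \<Longrightarrow> U \<noteq> {} \<Longrightarrow> \<exists>d\<in>D. d \<in> U"
    using countable_dense_exists[where ?'a = 'g] by blast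
  have "D \<noteq> {}" using D(2)[OF open_UNIV] by auto
  have dense: "closure (range (from_nat_into D)) = UNIV"
    using D(2)[of "- closure D"] closure_subset[of D] range_from_nat_into[OF \<open>D \<noteq> {}\<close> D(1)] by auto
  \<comment> \<open>The first component of the pair coded by \<open>p\<close> selects a set
    \<open>A m\<close>, the second a bump \<open>k n\<close>; the modulus depends on the bump
    alone.\<close>
  define \<omega> where "\<omega> p s = (SUP h. \<bar>k (snd (prod_decode p)) (h + s) - k (snd (prod_decode p)) h\<bar>)" for p s
  have \<omega>: "(\<omega> p \<longlongrightarrow> 0) (nhds 0)" for p
    unfolding \<omega>_def using k by (intro sup_translation_distance_tendsto)
  have \<omega>_upper: "\<bar>k (snd (prod_decode p)) (h + s) - k (snd (prod_decode p)) h\<bar> \<le> \<omega> p s" for p h s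
    unfolding \<omega>_def using k by (intro sup_translation_distance_tendsto)
  define F where "F x p g =
    category_sup {h. act h x \<in> A (fst (prod_decode p))} (\<lambda>h. k (snd (prod_decode p)) (h - g))" for x p g
  let ?r = "restrict_seq (from_nat_into D)" and ?L = "equicontinuous_functions \<omega>"
  have F: "F x \<in> ?L" for x
  proof -
    have le: "F x p g \<le> F x p g' + \<omega> p (g' - g)"
      and ge: "F x p g' \<le> F x p g + \<omega> p (g' - g)" for p g g'
    proof -
      \<comment> \<open>\<open>h - g\<close> equals \<open>(h - g') + (g' - g)\<close>, so the
        increment fed to \<open>\<omega>\<close> is free of \<open>h\<close>.\<close>
      have *: "\<bar>k (snd (prod_decode p)) (h - g) - k (snd (prod_decode p)) (h - g')\<bar> \<le> \<omega> p (g' - g)" for h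
        using \<omega>_upper[of p "h - g'" "g' - g"] by (simp add: algebra_simps)
      have "0 \<le> \<omega> p (g' - g)" using *[of 0] by linarith
      then show "F x p g \<le> F x p g' + \<omega> p (g' - g)" "F x p g' \<le> F x p g + \<omega> p (g' - g)"
        unfolding F_def using * k(2)
        by (intro category_sup_le_add; simp add: abs_le_iff algebra_simps)+
    qed
    have "\<bar>F x p g - F x p g'\<bar> \<le> \<omega> p (g' - g)" for p g g'
      using le[of p g g'] ge[of p g' g] by (simp add: abs_le_iff)
    then show ?thesis
      unfolding equicontinuous_functions_def F_def
      using k(2) by (auto intro!: category_sup_nonneg category_sup_le_one)
  qed
  define \<phi> where "\<phi> x = ?r (F x)" for x
  obtain \<beta> where \<beta>: "continuous_action (top_of_set (?r ` ?L)) \<beta>"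
    "\<forall>g. \<forall>u\<in>?L. \<beta> g (?r u) = ?r (\<lambda>p h. u p (h + g))"
    by (rule compact_shift_action[where \<omega> = \<omega>, OF \<omega> dense])
  have equiv: "\<phi> (act g x) = \<beta> g (\<phi> x)" if x: "x \<in> space M" for g x
  proof -
    \<comment> \<open>The visiting times of \<open>act g x\<close> are those of \<open>x\<close>
      pulled back along right translation by \<open>g\<close>, and the same translation moves the
      centre of the bump from \<open>h\<close> to \<open>h + g\<close>.\<close>
    have "F (act g x) p h = F x p (h + g)" for p h
    proof -
      have "{h'. act h' (act g x) \<in> A (fst (prod_decode p))}
          = (\<lambda>h. h + g) -` {h'. act h' x \<in> A (fst (prod_decode p))}"
        using action x by (auto simp: is_action_on_def)
      moreover have "h' + g - (h + g) = h' - h" for h'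
        by (simp add: diff_conv_add_uminus minus_add add.assoc del: add_uminus_conv_diff)
      ultimately show ?thesis
        using category_sup_translate[of g "{h'. act h' x \<in> A (fst (prod_decode p))}"
            "\<lambda>h'. k (snd (prod_decode p)) (h' - (h + g))"] by (simp add: F_def)
    qed
    then have "F (act g x) = (\<lambda>p h. F x p (h + g))" by blast
    then show ?thesis
      using \<beta>(2) F by (simp add: \<phi>_def)
  qed
  have sect: "{h. act h x \<in> A m} \<in> sets borel" if x: "x \<in> space M" for x m
  proof -
    have "(\<lambda>h. act h x) \<in> measurable borel M"
      using measurable_Pair1[OF act_meas x] by simp
    from measurable_sets[OF this A] show ?thesis by (simp add: vimage_def)
  qed
  have inj: "inj_on \<phi> (space M)"
  proof (rule inj_onI, rule ccontr)
    fix x y assume xy: "x \<in> space M" "y \<in> space M" "\<phi> x = \<phi> y" "x \<noteq> y"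
    have FF: "F x = F y"
      using xy(3) inj_onD[OF inj_on_restrict_seq[where \<omega> = \<omega>, OF \<omega> dense] _ F F] by (simp add: \<phi>_def)
    \<comment> \<open>Cancelling with \<open>- h\<close> keeps distinct points distinct at every
      time, so each time belongs to the difference of visiting sets for some
      \<open>m\<close>.\<close>
    have neq: "act h x \<noteq> act h y" for h
    proof
      assume "act h x = act h y"
      then have "act (- h + h) x = act (- h + h) y"
        using action xy unfolding is_action_on_def by metis
      then show False
        using action xy by (simp add: is_action_on_def)
    qed
    have in_space: "act h x \<in> space M" "act h y \<in> space M" for h
      using action xy by (auto simp: is_action_on_def)
    have "\<exists>m. act h x \<in> A m \<and> act h y \<notin> A m" for h
      by (rule sep[OF in_space neq])
    then have cover: "(\<Union>m. {h. act h x \<in> A m} - {h. act h y \<in> A m}) = UNIV"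
      by auto
    have nbhd: "\<exists>n. V n \<subseteq> U" if "open U" "0 \<in> U" for U
      using V(3)[OF that] eventually_happens'[OF sequentially_bot] by blast
    have "\<exists>m n g. category_sup {h. act h x \<in> A m} (\<lambda>h. k n (h - g))
         \<noteq> category_sup {h. act h y \<in> A m} (\<lambda>h. k n (h - g))"
      by (rule category_sup_separates[where V = V, OF lc _ _ cover nbhd k(3,2,4,5)])
        (intro baire_property_borel sect xy)+
    then obtain m n g where
      "category_sup {h. act h x \<in> A m} (\<lambda>h. k n (h - g))
         \<noteq> category_sup {h. act h y \<in> A m} (\<lambda>h. k n (h - g))"
      by blast
    then have "F x (prod_encode (m, n)) g \<noteq> F y (prod_encode (m, n)) g"
      by (simp add: F_def)
    with FF show False by simp
  qed
  have meas: "\<phi> \<in> borel_measurable M"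
  proof (intro measurable_coordinatewise_then_product)
    fix j
    \<comment> \<open>\<open>j\<close> codes a pair of an index \<open>p\<close> and a position in
      the dense sequence; \<open>p\<close> in turn codes \<open>(m, n)\<close>.\<close>
    define m n g where "m = fst (prod_decode (fst (prod_decode j)))"
      and "n = snd (prod_decode (fst (prod_decode j)))" and "g = from_nat_into D (snd (prod_decode j))"
    \<comment> \<open>For \<open>x\<close> in \<open>space M\<close>, the section of
      \<open>B\<close> at \<open>x\<close> is the set of times at which \<open>x\<close> visits
      \<open>A m\<close>.\<close>
    define B where "B = (\<lambda>(g, x). act g x) -` A m \<inter> space (borel \<Otimes>\<^sub>M M)"
    have "B \<in> sets (borel \<Otimes>\<^sub>M M)"
      unfolding B_def using act_meas A by (rule measurable_sets)
    moreover have "continuous_on UNIV (\<lambda>h. k n (h - g))"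
      by (intro continuous_on_compose2[OF k(3)])
        (auto simp: diff_conv_add_uminus simp del: add_uminus_conv_diff intro!: continuous_intros)
    ultimately have "(\<lambda>x. category_sup {h. (h, x) \<in> B} (\<lambda>h. k n (h - g))) \<in> borel_measurable M"
      using k(2) by (intro category_sup_measurable[OF lc]) auto
    moreover have "\<phi> x j = category_sup {h. (h, x) \<in> B} (\<lambda>h. k n (h - g))" if "x \<in> space M" for x
      using that by (simp add: \<phi>_def restrict_seq_def F_def B_def m_def n_def g_def space_pair_measure)
    ultimately show "(\<lambda>x. \<phi> x j) \<in> borel_measurable M"
      by (simp cong: measurable_cong)
  qed
  have "compact (?r ` ?L)"
    by (intro compact_continuous_image continuous_on_restrict_seq compact_equicontinuous_functions)
  moreover have "\<phi> ` space M \<subseteq> ?r ` ?L"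
    using F by (auto simp: \<phi>_def)
  ultimately show ?thesis
    using that \<beta>(1) meas inj equiv by blast
qed

theorem mainTheorem4:
  fixes M :: "'x measure"
    and act :: "'g::{topological_group_add, t2_space, second_countable_topology} \<Rightarrow> 'x \<Rightarrow> 'x"
  assumes "locally_compact_space (euclidean :: 'g topology)"
    and "standard_probability_space M"
    and "measurable_action M act"
    and "nonsingular_for M act"
  shows "\<exists>(K :: (nat \<Rightarrow> real) topology) (\<beta> :: 'g \<Rightarrow> (nat \<Rightarrow> real) \<Rightarrow> (nat \<Rightarrow> real)) \<nu> \<phi>.
           compact_space K \<and> metrizable_space K \<and>
           continuous_action K \<beta> \<and>
           prob_space \<nu> \<and> sets \<nu> = sets (borel_of K) \<and>
           nonsingular_for \<nu> \<beta> \<and>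
           measure_preserving_map M \<nu> \<phi> \<and>
           essentially_invertible M \<nu> \<phi> \<and>
           (\<forall>g. AE x in M. \<phi> (act g x) = \<beta> g (\<phi> x))"
proof -
  interpret prob_space M
    using assms(2) by (simp add: standard_probability_space_def)
  obtain e :: "'x \<Rightarrow> nat \<Rightarrow> real" where e: "e \<in> borel_measurable M" "inj_on e (space M)"
    "\<And>A. A \<in> sets M \<Longrightarrow> e ` A \<in> sets borel"
    using standard_probability_space_embedding[OF assms(2)] by blast
  obtain K :: "(nat \<Rightarrow> real) set" and \<beta> \<phi> where K: "compact K"
    and \<beta>: "continuous_action (top_of_set K) \<beta>"
    and \<phi>: "\<phi> \<in> borel_measurable M" "inj_on \<phi> (space M)" "\<phi> ` space M \<subseteq> K"
      "\<And>g x. x \<in> space M \<Longrightarrow> \<phi> (act g x) = \<beta> g (\<phi> x)"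
    using borel_action_equivariant_embedding[OF assms(1,3) e(1,2)] by blast
  obtain A where A: "A \<in> sets M" "space M - A \<in> null_sets M"
    "\<And>S. S \<in> sets M \<Longrightarrow> S \<subseteq> A \<Longrightarrow> \<phi> ` S \<in> sets borel"
    using bimeasurable_on_conull_set[OF prob_space_axioms e \<phi>(1,2)] by blast
  let ?N = "borel_of (top_of_set K)"
  have Kb: "K \<in> sets borel"
    using compact_imp_closed[OF K] by (rule borel_closed)
  have setsN: "sets ?N = sets (restrict_space borel K)"
    using Kb by (rule sets_borel_of_top_of_set)
  have setsN_iff: "B \<in> sets ?N \<longleftrightarrow> B \<subseteq> K \<and> B \<in> sets borel" for B
    using Kb by (simp add: setsN sets_restrict_space_iff)
  have \<phi>N: "\<phi> \<in> measurable M ?N"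
    unfolding measurable_cong_sets[OF refl setsN]
    using \<phi>(1,3) by (intro measurable_restrict_space2) auto
  \<comment> \<open>Being a push-forward, \<open>\<nu>\<close> makes \<open>\<phi>\<close> measure
    preserving.\<close>
  define \<nu> where "\<nu> = distr M ?N \<phi>"
  have sets\<nu>: "sets \<nu> = sets ?N" and space\<nu>: "space \<nu> = K"
    by (simp_all add: \<nu>_def space_borel_of)
  have \<nu>: "emeasure \<nu> B = emeasure M (\<phi> -` B \<inter> space M)" if "B \<in> sets ?N" for B
    unfolding \<nu>_def using \<phi>N that by (rule emeasure_distr)
  have \<phi>\<nu>: "\<phi> \<in> measurable M \<nu>"
    using \<phi>N measurable_cong_sets[OF refl sets\<nu>] by blast
  \<comment> \<open>Nonsingularity concerns null sets only, and those of \<open>\<nu>\<close> are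
    tested by pulling back along \<open>\<phi>\<close>.\<close>
  have null_\<nu>: "B \<in> null_sets \<nu> \<longleftrightarrow> B \<in> sets ?N \<and> \<phi> -` B \<inter> space M \<in> null_sets M" for B
    using \<nu>[of B] measurable_sets[OF \<phi>N, of B] by (auto simp: null_sets_def sets\<nu>)
  have nonsing: "nonsingular_for \<nu> \<beta>"
    unfolding nonsingular_for_def
  proof
    fix g
    have "(\<lambda>(g, x). act g x) \<circ> Pair g \<in> measurable M M"
      using assms(3) unfolding measurable_action_def
      by (intro measurable_comp[OF measurable_Pair1'[of g borel M]]) auto
    then have act_g: "act g \<in> measurable M M"
      by (simp add: comp_def)
    have "continuous_map (top_of_set K) (top_of_set K) (\<beta> g)"
    proof -
      have "continuous_map (top_of_set K) (prod_topology euclidean (top_of_set K)) (\<lambda>v. (g, v))"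
        by (intro continuous_map_pairedI) auto
      then have "continuous_map (top_of_set K) (top_of_set K) ((\<lambda>(g, x). \<beta> g x) \<circ> (\<lambda>v. (g, v)))"
        using \<beta> unfolding continuous_action_def by (blast intro: continuous_map_compose)
      then show ?thesis by (simp add: comp_def)
    qed
    then have "\<beta> g \<in> measurable ?N ?N"
      by (rule continuous_map_measurable_borel_of)
    then have \<beta>_g: "\<beta> g \<in> measurable \<nu> \<nu>"
      using measurable_cong_sets[OF sets\<nu> sets\<nu>] by blast
    have act_iff: "B \<in> null_sets (distr M M (act g)) \<longleftrightarrow> B \<in> sets M \<and> act g -` B \<inter> space M \<in> null_sets M" for B
      using act_g measurable_sets[OF act_g, of B] by (auto simp: null_sets_def emeasure_distr)
    \<comment> \<open>By equivariance, pulling back along \<open>\<beta> g\<close> and then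
      \<open>\<phi>\<close> agrees with pulling back along \<open>\<phi>\<close> and then
      \<open>act g\<close>.\<close>
    have \<beta>_iff: "B \<in> null_sets (distr \<nu> \<nu> (\<beta> g))
        \<longleftrightarrow> B \<in> sets ?N \<and> \<phi> -` B \<inter> space M \<in> null_sets (distr M M (act g))" for B
    proof (cases "B \<in> sets ?N")
      case True
      have "\<phi> -` (\<beta> g -` B \<inter> space \<nu>) \<inter> space M = act g -` (\<phi> -` B \<inter> space M) \<inter> space M"
        using \<phi>(3,4) measurable_space[OF act_g] by (auto simp: space\<nu>)
      moreover have "\<beta> g -` B \<inter> space \<nu> \<in> sets ?N"
        using measurable_sets[OF \<beta>_g, of B] True sets\<nu> by simp
      ultimately show ?thesis
        using True \<nu>[of "\<beta> g -` B \<inter> space \<nu>"] \<beta>_g act_iff measurable_sets[OF \<phi>N True]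
          measurable_sets[OF act_g measurable_sets[OF \<phi>N True]]
        by (auto simp: null_sets_def emeasure_distr sets\<nu>)
    qed (auto simp: null_sets_def sets\<nu>)
    show "absolutely_continuous \<nu> (distr \<nu> \<nu> (\<beta> g)) \<and> absolutely_continuous (distr \<nu> \<nu> (\<beta> g)) \<nu>"
    proof -
      have "null_sets (distr M M (act g)) = null_sets M"
        using assms(4) unfolding nonsingular_for_def absolutely_continuous_def by blast
      then show ?thesis
        unfolding absolutely_continuous_def by (auto simp: null_\<nu> \<beta>_iff)
    qed
  qed
  have "essentially_invertible M \<nu> \<phi>"
    unfolding essentially_invertible_def
  proof (intro bexI conjI)
    have AX: "A \<subseteq> space M" using A(1) sets.sets_into_space by blast
    show "space M - A \<in> null_sets M" "A \<in> sets M" by fact+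
    show B: "\<phi> ` A \<in> sets \<nu>"
      using A(1,3) AX \<phi>(3) by (auto simp: sets\<nu> setsN_iff)
    \<comment> \<open>Injectivity on all of \<open>space M\<close> prevents points outside
      \<open>A\<close> from landing in the image of \<open>A\<close>.\<close>
    have "\<phi> -` (space \<nu> - \<phi> ` A) \<inter> space M = space M - A"
      using \<phi>(3) inj_on_image_mem_iff[OF \<phi>(2) _ AX] by (auto simp: space\<nu> image_subset_iff)
    then show "space \<nu> - \<phi> ` A \<in> null_sets \<nu>"
      using A(2) B by (simp add: null_\<nu> sets.compl_sets flip: sets\<nu>)
    show bij: "bij_betw \<phi> A (\<phi> ` A)"
      using \<phi>(2) AX by (auto simp: bij_betw_def intro: inj_on_subset)
    show "inv_into A \<phi> \<in> measurable (restrict_space \<nu> (\<phi> ` A)) (restrict_space M A)"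
    proof (rule measurableI)
      fix v assume "v \<in> space (restrict_space \<nu> (\<phi> ` A))"
      then show "inv_into A \<phi> v \<in> space (restrict_space M A)"
        using AX inv_into_into[of v \<phi> A] by (auto simp: space_restrict_space)
    next
      fix S assume "S \<in> sets (restrict_space M A)"
      then have S: "S \<subseteq> A" "S \<in> sets M"
        using A(1) by (auto simp: sets_restrict_space_iff)
      \<comment> \<open>Preimages under the inverse are direct images under \<open>\<phi>\<close>,
        and \<open>A\<close> was chosen so that these are Borel.\<close>
      have "inv_into A \<phi> -` S \<inter> space (restrict_space \<nu> (\<phi> ` A)) = \<phi> ` S"
        using S(1) bij \<phi>(3) AX
        by (auto simp: space_restrict_space space\<nu> bij_betw_def inv_into_f_f subset_iff)
      moreover have "\<phi> ` S \<in> sets (restrict_space \<nu> (\<phi> ` A))"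
        using B S A(3)[OF S(2,1)] \<phi>(3) AX by (auto simp: sets_restrict_space_iff sets\<nu> setsN_iff)
      ultimately show "inv_into A \<phi> -` S \<inter> space (restrict_space \<nu> (\<phi> ` A))
          \<in> sets (restrict_space \<nu> (\<phi> ` A))"
        by simp
    qed
  qed
  moreover have "measure_preserving_map M \<nu> \<phi>"
    unfolding measure_preserving_map_def using \<phi>\<nu> \<nu> by (simp add: sets\<nu>)
  moreover have "prob_space \<nu>"
    unfolding \<nu>_def using \<phi>N by (rule prob_space_distr)
  moreover have "compact_space (top_of_set K)" "metrizable_space (top_of_set K)"
    using K by (auto simp: compact_space_subtopology metrizable_space_subtopology metrizable_space_euclidean)
  moreover have "AE x in M. \<phi> (act g x) = \<beta> g (\<phi> x)" for g
    using \<phi>(4) by (intro AE_I2)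
  ultimately show ?thesis
    using \<beta> nonsing sets\<nu> by blast
qed

end
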